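(* Let $r\leqslant 1$ be an integer coprime with $3$. Let $p$ be a prime such that $p\equiv -r\pmod{3}$ and $p\geqslant 3-r$. Then $$\sum_{k=0}^{p-1} (6k+r) \frac{\left(\frac{r}{3}\right)_k^6}{k!^6} \equiv \frac{(-1)^{r+1}\,80rp^4}{81}\cdot \frac{\Gamma_p\!\left(1+\frac{r}{3}\right)^2} {\Gamma_p\!\left(1+\frac{2r}{3}\right)^3 \Gamma_p\!\left(1-\frac{r}{3}\right)^4} \sum_{k=0}^{1-r}\frac{(r-1)_k\left(\frac{r}{3}\right)_k^3} {(1)_k\left(\frac{2r}{3}\right)_k^3} \pmod{p^5}.$$
   Context: For a number $a$ and a non-negative integer $k$, $(a)_k=a(a+1)\cdots(a+k-1)$ denotes the Pochhammer symbol, with $(a)_0=1$. $\Gamma_p$ denotes Morita's $p$-adic Gamma function: for positive integers $n$, $\Gamma_p(n)=(-1)^n\prod_{0<j<n,\ p\nmid j} j$, and $\Gamma_p$ is extended to $\mathbb{Z}_p$ by continuity (note $\frac{r}{3},\frac{2r}{3}\in\mathbb{Z}_p$ since $p\neq 3$). Congruences modulo $p^5$ are understood in $\mathbb{Z}_p$: two $p$-adic integers are congruent modulo $p^5$ if their difference lies in $p^5\mathbb{Z}_p$. *)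

theory Defs
  imports Main "HOL-Number_Theory.Number_Theory"
begin

definition padic_integral :: "nat \<Rightarrow> rat \<Rightarrow> bool" where
  "padic_integral p q \<longleftrightarrow> \<not> int p dvd snd (quotient_of q)"

definition padic_cong :: "nat \<Rightarrow> nat \<Rightarrow> rat \<Rightarrow> rat \<Rightarrow> bool" where
  "padic_cong p N a b \<longleftrightarrow> (\<exists>q. padic_integral p q \<and> a - b = of_nat p ^ N * q)"

definition padic_tendsto :: "nat \<Rightarrow> (nat \<Rightarrow> nat) \<Rightarrow> rat \<Rightarrow> bool" where
  "padic_tendsto p n x \<longleftrightarrow> (\<forall>K. \<exists>J. \<forall>j\<ge>J. padic_cong p K (of_nat (n j)) x)"

text \<open>Morita's p-adic Gamma function on positive integers:
  Gamma_p(n) = (-1)^n * prod of 0<j<n with p not dividing j.\<close>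
definition gamma_p_nat :: "nat \<Rightarrow> nat \<Rightarrow> int" where
  "gamma_p_nat p n = (-1) ^ n * (\<Prod>j\<in>{j. 0 < j \<and> j < n \<and> \<not> p dvd j}. int j)"

end

(* Write a = r/3 and n = (2p - r)/3, so that -n = a - 2p/3, and let z be a primitive fifth root
of unity, t_i = (2p/3) z^i. The product of the (a - t_i)_k over all i differs from (a)_k^5 only by
multiples of p^5, and likewise the product of the (1 + t_i)_k from k!^5, so modulo p^5 the sum is a
terminating very-well-poised 7F6 with parameters a - t_i. Whipple's transformation followed by
Sears' transformation turns it into p * (Gamma-type factors) * (a balanced 4F3); because the t_i
add up to 0, one numerator parameter is exactly r - 1, so the 4F3 has only 2 - r terms. Each of its
terms contains the three factors (p/3)(1 + 2 z^4 + 2 z^j), j = 1, 2, 3, whose product is -5 p^3/27.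
This exhibits a factor p^4, and the cofactor only has to be known modulo p, where Wilson's theorem
identifies it with the Gamma_p expression. *)

theory Submission
  imports Defs Complex_Main
begin

text \<open>The sixth power splits as 1 + 5: one \<open>(a)_k\<close> over one \<open>k!\<close>
  stays exact as the leading well-poised pair, and only the other five are perturbed. Moving a
  single parameter to \<open>-n\<close> would cost an error of order \<open>p\<close>; spreading the
  shift over all fifth roots of unity puts \<open>x^5 - t_0^5\<close> in place of
  \<open>x^5\<close>, so the error is of order \<open>p^5\<close>, and the sum still terminates
  because \<open>a - t_0 = -n\<close>. Of the four powers of \<open>p\<close>, one is the factor
  \<open>a + n = 2p/3\<close> of \<open>(a)_(n+1)\<close>. The other three arise where
  \<open>1 - a\<close> plus \<open>q - 1\<close> equals \<open>p/3\<close>, with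
  \<open>q = (p + r)/3\<close>; after the shift this becomes \<open>p/3 + t_4 + t_j\<close>. The
  price is a ring that is not rational. The transformations divide freely, so they are proved over
  fields of characteristic 0 and applied in the complex numbers, while congruences live in the
  subring generated by \<open>Z_(p)\<close> and \<open>z\<close>. Both sides of the final congruence
  are rational, and a rational element of that subring already lies in \<open>Z_(p)\<close>, which
  carries the result back.\<close>

section \<open>Hypergeometric transformations\<close>

text \<open>The Pfaff-Saalschuetz summation with all denominators cleared, hence a polynomial
  identity over any commutative ring. The parameter \<open>d\<close> is free:
  \<open>bailey_lemma\<close> takes \<open>A + 2 k\<close>, and \<open>sears_transformation\<close>
  takes the bottom parameter \<open>F\<close>.\<close>

lemma saalschuetz:
  fixes b c d :: "'a::comm_ring_1"
  shows "pochhammer b k * pochhammer c k =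
    (\<Sum>j\<le>k. of_nat (k choose j) * pochhammer (d - b) j * pochhammer (d - c) j
       * pochhammer (d + of_nat j) (k - j) * pochhammer (b + c - d) (k - j))"
proof (induction k)
  case 0
  then show ?case by simp
next
  case (Suc k)
  define X where "X j = pochhammer (d - b) j * pochhammer (d - c) j" for j
  define e where "e = b + c - d"
  define A where "A j = of_nat (k choose j) * X (Suc j)
       * pochhammer (d + of_nat j) (k - j) * pochhammer e (k - j)" for j
  define B where "B j = of_nat (k choose j) * X j
       * pochhammer (d + of_nat j) (k - j) * (d + of_nat k + of_nat j) * pochhammer e (Suc k - j)" for j
  define T where "T j = of_nat (Suc k choose j) * X j
       * pochhammer (d + of_nat j) (Suc k - j) * pochhammer e (Suc k - j)" for j
  define A' where "A' j = (case j of 0 \<Rightarrow> 0 | Suc i \<Rightarrow> A i)" for j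
  \<comment> \<open>\<open>(b + k)(c + k) = (d - b + j)(d - c + j) + (d + k + j)(b + c - d + k - j)\<close> turns the
    \<open>j\<close>-th summand for \<open>k\<close> into contributions to the summands \<open>j + 1\<close> and \<open>j\<close> for \<open>k + 1\<close>\<close>
  have split: "(b + of_nat k) * (c + of_nat k) * (of_nat (k choose j) * X j
       * pochhammer (d + of_nat j) (k - j) * pochhammer e (k - j)) = A j + B j" if jk: "j \<le> k" for j
  proof -
    obtain m where m: "k = j + m" using le_Suc_ex[OF jk] by blast
    have [simp]: "Suc (j + m) - j = Suc m" by simp
    have 1: "(b + of_nat k) * (c + of_nat k) = (d - b + of_nat j) * (d - c + of_nat j)
       + (d + of_nat k + of_nat j) * (e + of_nat m)"
      by (simp add: m e_def algebra_simps)
    have 2: "A j = of_nat (k choose j) * X j * pochhammer (d + of_nat j) m * pochhammer e m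
        * ((d - b + of_nat j) * (d - c + of_nat j))"
      by (simp add: A_def X_def m pochhammer_Suc mult_ac)
    have 3: "B j = of_nat (k choose j) * X j * pochhammer (d + of_nat j) m * pochhammer e m
        * ((d + of_nat k + of_nat j) * (e + of_nat m))"
      by (simp add: B_def m pochhammer_Suc mult_ac)
    have "A j + B j = of_nat (k choose j) * X j * pochhammer (d + of_nat j) m * pochhammer e m
        * ((b + of_nat k) * (c + of_nat k))"
      unfolding 1 2 3 by (rule distrib_left[symmetric])
    then show ?thesis
      by (simp add: m mult_ac)
  qed
  have "pochhammer b (Suc k) * pochhammer c (Suc k)
     = (b + of_nat k) * (c + of_nat k) * (pochhammer b k * pochhammer c k)"
    by (simp add: pochhammer_Suc algebra_simps)
  also have "\<dots> = (\<Sum>j\<le>k. A j + B j)"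
    unfolding Suc.IH sum_distrib_left
    by (intro sum.cong refl) (use split in \<open>auto simp: X_def e_def mult.assoc\<close>)
  also have "\<dots> = (\<Sum>j\<le>Suc k. A' j) + (\<Sum>j\<le>Suc k. B j)"
  proof -
    have "(\<Sum>j\<le>Suc k. A' j) = (\<Sum>j\<le>k. A j)"
      by (subst sum.atMost_Suc_shift) (simp add: A'_def)
    moreover have "B (Suc k) = 0" by (simp add: B_def binomial_eq_0)
    ultimately show ?thesis by (simp add: sum.distrib)
  qed
  also have "\<dots> = (\<Sum>j\<le>Suc k. T j)"
    unfolding sum.distrib[symmetric]
  proof (intro sum.cong refl)
    fix j assume j: "j \<in> {..Suc k}"
    show "A' j + B j = T j"
    proof (cases j)
      case 0
      then show ?thesis by (simp add: A'_def B_def T_def pochhammer_Suc)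
    next
      case (Suc i)
      show ?thesis
      proof (cases "i = k")
        case True
        then show ?thesis using Suc by (simp add: A'_def A_def B_def T_def binomial_eq_0)
      next
        case False
        then obtain m where m: "k = i + Suc m"
          using j Suc by (metis atMost_iff le_neq_implies_less less_imp_Suc_add Suc_le_mono add_Suc_right)
        have km: "k - i = Suc m" "k - Suc i = m" "Suc k - Suc i = Suc m" "Suc k - i = Suc (Suc m)"
          using m by auto
        define y where "y = pochhammer (d + of_nat i + 1) m"
        have y1: "pochhammer (d + of_nat i) (Suc m) = (d + of_nat i) * y"
          by (simp add: y_def pochhammer_rec)
        have y2: "pochhammer (d + of_nat (Suc i)) (Suc m) = (d + of_nat k) * y"
          by (simp add: y_def pochhammer_rec' m algebra_simps)
        have y3: "pochhammer (d + of_nat (Suc i)) m = y"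
          by (simp add: y_def algebra_simps)
        have "(Suc i) * (k choose Suc i) = (k choose i) * Suc m"
          using binomial_absorb_comp[of k i] binomial_absorption[of i k] km by (simp add: mult.commute)
        then have "of_nat ((Suc i) * (k choose Suc i)) = (of_nat ((k choose i) * Suc m) :: 'a)"
          by simp
        then have bin: "of_nat (k choose Suc i) * (of_nat i + 1) = of_nat (k choose i) * (of_nat m + 1 :: 'a)"
          by (simp add: algebra_simps)
        have kk: "of_nat k = of_nat i + of_nat m + (1::'a)" using m by simp
        have "of_nat (k choose i) * (d + of_nat i) + of_nat (k choose Suc i) * (d + of_nat k + of_nat (Suc i))
            = of_nat (Suc k choose Suc i) * (d + of_nat k)"
          using bin unfolding kk by (simp add: algebra_simps)
        then have "X (Suc i) * y * pochhammer e (Suc m) * (of_nat (k choose i) * (d + of_nat i) + of_nat (k choose Suc i) * (d + of_nat k + of_nat (Suc i)))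
            = X (Suc i) * y * pochhammer e (Suc m) * (of_nat (Suc k choose Suc i) * (d + of_nat k))"
          by simp
        then show ?thesis
          unfolding Suc A'_def A_def B_def T_def km y1 y2 y3 nat.case
          by (simp only: ring_distribs mult_ac)
      qed
    qed
  qed
  finally show ?case
    by (simp add: T_def X_def e_def mult.assoc)
qed

text \<open>Reading the product backwards turns each factor into minus a factor of the other
  symbol.\<close>

lemma pochhammer_reflect:
  fixes x :: "'a::comm_ring_1"
  shows "pochhammer x m = (-1) ^ m * pochhammer (1 - x - of_nat m) m"
proof (induction m arbitrary: x)
  case 0
  then show ?case by simp
next
  case (Suc m)
  have "pochhammer x (Suc m) = x * pochhammer (x + 1) m" by (simp add: pochhammer_rec)
  also have "\<dots> = x * ((-1) ^ m * pochhammer (1 - (x + 1) - of_nat m) m)"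
    using Suc[of "x + 1"] by simp
  also have "1 - (x + 1) - of_nat m = 1 - x - of_nat (Suc m)" by simp
  also have "x * ((-1) ^ m * pochhammer (1 - x - of_nat (Suc m)) m)
     = (-1) ^ Suc m * pochhammer (1 - x - of_nat (Suc m)) (Suc m)"
    by (simp add: pochhammer_rec' algebra_simps)
  finally show ?case .
qed

lemma pochhammer_minus_of_nat:
  assumes "k \<le> n"
  shows "pochhammer (- of_nat n) k = ((-1) ^ k * (fact n / fact (n - k)) :: 'a::field_char_0)"
proof -
  have "(fact n :: 'a) = fact (n - k) * pochhammer (of_nat n - of_nat k + 1) k"
    using assms pochhammer_product'[of "1::'a" "n - k" k]
    by (simp add: pochhammer_fact of_nat_diff add_ac)
  then have "pochhammer (of_nat n - of_nat k + 1) k = (fact n / fact (n - k) :: 'a)"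
    by simp
  then show ?thesis by (simp add: pochhammer_minus)
qed

text \<open>This is \<open>saalschuetz\<close> with \<open>d = u\<close>: the balancing condition
  determines \<open>v\<close>, and reflection turns \<open>(v - x)_M\<close> into
  \<open>(u - y)_M\<close> and \<open>(v + m)_(M-m)\<close> into \<open>(u - x - y)_(M-m)\<close>.
  The alternating sign comes from these reflections.\<close>

lemma saalschuetz_balanced:
  fixes x y u v :: "'a::comm_ring_1"
  assumes "u + v = x + y + 1 - of_nat M"
  shows "(\<Sum>m\<le>M. (-1) ^ m * of_nat (M choose m) * pochhammer x m * pochhammer y m
       * pochhammer (u + of_nat m) (M - m) * pochhammer (v + of_nat m) (M - m))
     = pochhammer (u - x) M * pochhammer (v - x) M"
proof -
  have v: "v = 1 - of_nat M - (u - x - y)" using assms by (simp add: algebra_simps)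
  have "pochhammer (v - x) M = (-1) ^ M * pochhammer (u - y) M"
    using pochhammer_reflect[of "v - x" M] by (simp add: v algebra_simps)
  then have "pochhammer (u - x) M * pochhammer (v - x) M
     = (-1) ^ M * (pochhammer (u - x) M * pochhammer (u - y) M)" by simp
  also have "\<dots> = (\<Sum>m\<le>M. (-1) ^ M * (of_nat (M choose m) * pochhammer x m * pochhammer y m
       * pochhammer (u + of_nat m) (M - m) * pochhammer (u - x - y) (M - m)))"
    by (subst saalschuetz[of _ _ _ u]) (simp add: sum_distrib_left algebra_simps)
  also have "\<dots> = (\<Sum>m\<le>M. (-1) ^ m * of_nat (M choose m) * pochhammer x m * pochhammer y m
       * pochhammer (u + of_nat m) (M - m) * pochhammer (v + of_nat m) (M - m))"
  proof (intro sum.cong refl)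
    fix m assume "m \<in> {..M}"
    then have mM: "m \<le> M" by simp
    have arg: "1 - (v + of_nat m) - of_nat (M - m) = u - x - y"
      using mM by (simp add: v of_nat_diff algebra_simps)
    have P: "pochhammer (v + of_nat m) (M - m) = (-1) ^ (M - m) * pochhammer (u - x - y) (M - m)"
      using pochhammer_reflect[of "v + of_nat m" "M - m"] unfolding arg .
    have sgn: "(-1) ^ M = (-1 :: 'a) ^ m * (-1) ^ (M - m)"
      using mM by (simp flip: power_add)
    show "(-1) ^ M * (of_nat (M choose m) * pochhammer x m * pochhammer y m
       * pochhammer (u + of_nat m) (M - m) * pochhammer (u - x - y) (M - m))
      = (-1) ^ m * of_nat (M choose m) * pochhammer x m * pochhammer y m
       * pochhammer (u + of_nat m) (M - m) * pochhammer (v + of_nat m) (M - m)"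
      unfolding P sgn by (simp only: mult_ac)
  qed
  finally show ?thesis by simp
qed

lemma sum_triangle_shift:
  fixes f :: "nat \<Rightarrow> nat \<Rightarrow> 'a::comm_monoid_add"
  shows "(\<Sum>j\<le>L. \<Sum>k\<le>j. f j k) = (\<Sum>k\<le>L. \<Sum>i\<le>L - k. f (k + i) k)"
proof (induction L)
  case (Suc L)
  have "(\<Sum>k\<le>L. \<Sum>i\<le>Suc L - k. f (k + i) k) = (\<Sum>k\<le>L. (\<Sum>i\<le>L - k. f (k + i) k) + f (Suc L) k)"
    by (intro sum.cong refl) (simp add: Suc_diff_le)
  then show ?case using Suc by (simp add: sum.distrib add_ac)
qed simp

text \<open>The sum telescopes: its partial sums have a closed form, and the last term cancels the
  preceding ones. It exhibits the Bailey pair whose \<open>\<beta>\<close> is 1 at index 0 and 0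
  elsewhere, the seed of \<open>whipple_transformation\<close>.\<close>

lemma unit_bailey_pair:
  fixes a :: "'a::field_char_0"
  assumes a: "\<And>m. pochhammer a m \<noteq> 0"
  shows "(\<Sum>k\<le>L. (-1) ^ k * pochhammer a k * (a + 2 * of_nat k)
            / (fact k * (fact (L - k) * pochhammer a (Suc (L + k)))))
       = (if L = 0 then 1 else 0)"
proof (cases L)
  case 0
  have "a \<noteq> 0" using a[of 1] by simp
  then show ?thesis using 0 by simp
next
  case (Suc L')
  define t where "t k = (-1) ^ k * pochhammer a k * (a + 2 * of_nat k)
            / (fact k * (fact (L - k) * pochhammer a (Suc (L + k))))" for k
  have nz: "a + of_nat m \<noteq> 0" for m
    using a[of "Suc m"] by (simp add: pochhammer_Suc)
  have Lnz: "(of_nat L :: 'a) \<noteq> 0" by (simp only: of_nat_eq_0_iff Suc nat.distinct not_False_eq_True)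
  \<comment> \<open>Here \<open>l\<close> is \<open>L - m - 1\<close>; the closed form is valid only
    for \<open>m < L\<close>, so the term \<open>k = L\<close> is treated separately below.\<close>
  have partial: "(\<Sum>k\<le>m. t k) = (-1) ^ m * pochhammer a (Suc m)
      / (fact m * (fact l * (of_nat L * pochhammer a (Suc (L + m)))))" if "L = Suc (m + l)" for m l
    using that
  proof (induction m arbitrary: l)
    case 0
    then show ?case by (simp add: t_def mult_ac)
  next
    case (Suc m)
    have L: "L = Suc (m + Suc l)" using Suc.prems by simp
    define x y where "x = pochhammer a (Suc m)" and "y = pochhammer a (Suc (L + m))"
    have xy: "pochhammer a (Suc (Suc m)) = x * (a + of_nat m + 1)"
        "pochhammer a (Suc (L + Suc m)) = y * (a + of_nat L + of_nat m + 1)"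
      by (simp_all add: x_def y_def pochhammer_Suc add_ac)
    have ynz: "y \<noteq> 0" "a + of_nat L + of_nat m + 1 \<noteq> 0"
      using a[of "Suc (L + m)"] nz[of "L + m + 1"] by (simp_all add: y_def add_ac)
    have diff: "L - Suc m = Suc l" using L by simp
    define v w :: 'a where "v = of_nat (Suc m)" and "w = of_nat (Suc l)"
    define D where "D = a + of_nat L + of_nat m + 1"
    have fct: "fact (Suc m) = v * fact m" "fact (Suc l) = w * fact l"
      by (simp_all only: fact_Suc v_def w_def)
    have nz': "v \<noteq> 0" "w \<noteq> 0" "D \<noteq> 0"
      using ynz by (simp_all only: v_def w_def D_def of_nat_eq_0_iff nat.distinct not_False_eq_True)
    have "t (Suc m) = - ((-1) ^ m * x * (a + 2 * v) / (v * fact m * (w * fact l * (y * D))))"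
      unfolding t_def diff fct xy add_Suc_right
      by (simp add: x_def v_def y_def D_def pochhammer_Suc add_ac)
    then have "(\<Sum>k\<le>Suc m. t k) = (-1) ^ m * x / (fact m * (w * fact l * (of_nat L * y)))
       - (-1) ^ m * x * (a + 2 * v) / (v * fact m * (w * fact l * (y * D)))"
      using Suc.IH[OF L] unfolding sum.atMost_Suc fct x_def y_def by simp
    also have "\<dots> = (-1) ^ m * x * (v * D - of_nat L * (a + 2 * v))
       / (v * fact m * (w * fact l * (of_nat L * (y * D))))"
      using nz' ynz Lnz by (simp add: field_simps)
    also have "v * D - of_nat L * (a + 2 * v) = - (w * (a + of_nat m + 1))"
      by (simp add: v_def w_def D_def L algebra_simps)
    also have "(-1) ^ m * x * - (w * (a + of_nat m + 1)) / (v * fact m * (w * fact l * (of_nat L * (y * D))))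
      = (-1) ^ Suc m * (x * (a + of_nat m + 1)) / (v * fact m * (fact l * (of_nat L * (y * D))))"
      using nz' by simp
    finally show ?case unfolding xy fct D_def .
  qed
  have "(\<Sum>k\<le>L. t k) = (\<Sum>k\<le>L'. t k) + t L" using Suc by simp
  also have "(\<Sum>k\<le>L'. t k) = (-1) ^ L' * pochhammer a L / (fact L * pochhammer a (L + L))"
    using partial[of L' 0] Suc by (simp add: fact_Suc mult_ac)
  also have "t L = - ((-1) ^ L' * pochhammer a L / (fact L * pochhammer a (L + L)))"
  proof -
    have "pochhammer a (Suc (L + L)) = pochhammer a (L + L) * (a + 2 * of_nat L)"
      by (simp add: pochhammer_Suc)
    moreover have "a + 2 * of_nat L \<noteq> 0" using nz[of "2 * L"] by simp
    ultimately have "t L = (-1) ^ L * pochhammer a L / (fact L * pochhammer a (L + L))"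
      by (simp add: t_def del: of_nat_Suc)
    then show ?thesis using Suc by simp
  qed
  finally show ?thesis using Suc by (simp add: t_def)
qed

text \<open>Bailey's lemma in finite form, with \<open>A\<close> in the role of
  \<open>1 + a\<close>. Inserting the definition of \<open>\<beta>\<close> and exchanging the sums
  leaves, for each \<open>\<alpha> k\<close>, an inner sum that \<open>saalschuetz\<close> evaluates
  with \<open>d = A + 2 k\<close>.\<close>

lemma bailey_lemma:
  fixes A \<rho> \<sigma> :: "'a::field_char_0"
  assumes A: "\<And>m. pochhammer A m \<noteq> 0" "\<And>m. pochhammer (A - \<rho>) m \<noteq> 0" "\<And>m. pochhammer (A - \<sigma>) m \<noteq> 0"
    and \<beta>: "\<And>j. \<beta> j = (\<Sum>k\<le>j. \<alpha> k / (fact (j - k) * pochhammer A (j + k)))"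
  shows "(\<Sum>j\<le>L. pochhammer \<rho> j * pochhammer \<sigma> j * pochhammer (A - \<rho> - \<sigma>) (L - j) / fact (L - j) * \<beta> j)
    = pochhammer (A - \<rho>) L * pochhammer (A - \<sigma>) L *
      (\<Sum>k\<le>L. pochhammer \<rho> k * pochhammer \<sigma> k / (pochhammer (A - \<rho>) k * pochhammer (A - \<sigma>) k) * \<alpha> k
          / (fact (L - k) * pochhammer A (L + k)))"
proof -
  have inner: "(\<Sum>i\<le>M. pochhammer \<rho> (k + i) * pochhammer \<sigma> (k + i) * pochhammer (A - \<rho> - \<sigma>) (M - i)
        / (fact (M - i) * (fact i * pochhammer A (k + i + k))))
     = pochhammer \<rho> k * pochhammer \<sigma> k * (pochhammer (A - \<rho> + of_nat k) M * pochhammer (A - \<sigma> + of_nat k) M)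
        / (fact M * pochhammer A (k + M + k))" for k M
  proof -
    have "(\<Sum>i\<le>M. pochhammer \<rho> (k + i) * pochhammer \<sigma> (k + i) * pochhammer (A - \<rho> - \<sigma>) (M - i)
        / (fact (M - i) * (fact i * pochhammer A (k + i + k))))
      = (\<Sum>i\<le>M. pochhammer \<rho> k * pochhammer \<sigma> k / (fact M * pochhammer A (k + M + k)) *
          (of_nat (M choose i) * pochhammer (\<rho> + of_nat k) i * pochhammer (\<sigma> + of_nat k) i
            * pochhammer (A + 2 * of_nat k + of_nat i) (M - i) * pochhammer (A - \<rho> - \<sigma>) (M - i)))"
    proof (intro sum.cong refl)
      fix i assume "i \<in> {..M}"
      then have i: "i \<le> M" by simp
      have "pochhammer A (k + M + k) = pochhammer A (k + i + k) * pochhammer (A + 2 * of_nat k + of_nat i) (M - i)"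
        using pochhammer_product'[of A "k + i + k" "M - i"] i by (simp add: algebra_simps)
      moreover have "pochhammer A (k + M + k) \<noteq> 0" "pochhammer A (k + i + k) \<noteq> 0" using A(1) by blast+
      ultimately have pA: "1 / pochhammer A (k + i + k) = pochhammer (A + 2 * of_nat k + of_nat i) (M - i) / pochhammer A (k + M + k)"
        by (simp add: divide_simps)
      have "of_nat (M choose i) = (fact M / (fact i * fact (M - i)) :: 'a)"
        using i by (rule binomial_fact)
      then have bin: "1 / (fact (M - i) * fact i) = (of_nat (M choose i) / fact M :: 'a)"
        by simp
      have "pochhammer \<rho> (k + i) * pochhammer \<sigma> (k + i) * pochhammer (A - \<rho> - \<sigma>) (M - i)
          / (fact (M - i) * (fact i * pochhammer A (k + i + k)))
        = pochhammer \<rho> (k + i) * pochhammer \<sigma> (k + i) * pochhammer (A - \<rho> - \<sigma>) (M - i)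
          * (1 / (fact (M - i) * fact i)) * (1 / pochhammer A (k + i + k))" by simp
      also have "\<dots> = pochhammer \<rho> k * pochhammer \<sigma> k / (fact M * pochhammer A (k + M + k)) *
          (of_nat (M choose i) * pochhammer (\<rho> + of_nat k) i * pochhammer (\<sigma> + of_nat k) i
            * pochhammer (A + 2 * of_nat k + of_nat i) (M - i) * pochhammer (A - \<rho> - \<sigma>) (M - i))"
        unfolding bin pA by (simp add: pochhammer_product')
      finally show "pochhammer \<rho> (k + i) * pochhammer \<sigma> (k + i) * pochhammer (A - \<rho> - \<sigma>) (M - i)
          / (fact (M - i) * (fact i * pochhammer A (k + i + k))) = \<dots>" .
    qed
    also have "\<dots> = pochhammer \<rho> k * pochhammer \<sigma> k / (fact M * pochhammer A (k + M + k)) *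
        (pochhammer (A - \<rho> + of_nat k) M * pochhammer (A - \<sigma> + of_nat k) M)"
      by (subst saalschuetz[of _ _ _ "A + 2 * of_nat k"])
         (simp add: sum_distrib_left algebra_simps)
    finally show ?thesis by simp
  qed
  define g where "g j = pochhammer \<rho> j * pochhammer \<sigma> j * pochhammer (A - \<rho> - \<sigma>) (L - j) / fact (L - j)" for j
  have "(\<Sum>j\<le>L. g j * \<beta> j) = (\<Sum>j\<le>L. \<Sum>k\<le>j. g j * (\<alpha> k / (fact (j - k) * pochhammer A (j + k))))"
    by (simp add: \<beta> sum_distrib_left)
  also have "\<dots> = (\<Sum>k\<le>L. \<Sum>i\<le>L - k. g (k + i) * (\<alpha> k / (fact (k + i - k) * pochhammer A (k + i + k))))"
    by (rule sum_triangle_shift)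
  also have "\<dots> = (\<Sum>k\<le>L. \<alpha> k * (\<Sum>i\<le>L - k. pochhammer \<rho> (k + i) * pochhammer \<sigma> (k + i) * pochhammer (A - \<rho> - \<sigma>) (L - k - i)
        / (fact (L - k - i) * (fact i * pochhammer A (k + i + k)))))"
    by (simp add: sum_distrib_left g_def algebra_simps)
  also have "\<dots> = (\<Sum>k\<le>L. pochhammer (A - \<rho>) L * pochhammer (A - \<sigma>) L *
      (pochhammer \<rho> k * pochhammer \<sigma> k / (pochhammer (A - \<rho>) k * pochhammer (A - \<sigma>) k) * \<alpha> k
          / (fact (L - k) * pochhammer A (L + k))))"
  proof (intro sum.cong refl)
    fix k assume "k \<in> {..L}"
    then have k: "k \<le> L" by simp
    have *: "pochhammer (A - \<rho>) L = pochhammer (A - \<rho>) k * pochhammer (A - \<rho> + of_nat k) (L - k)"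
      "pochhammer (A - \<sigma>) L = pochhammer (A - \<sigma>) k * pochhammer (A - \<sigma> + of_nat k) (L - k)"
      using k by (rule pochhammer_product)+
    show "\<alpha> k * (\<Sum>i\<le>L - k. pochhammer \<rho> (k + i) * pochhammer \<sigma> (k + i) * pochhammer (A - \<rho> - \<sigma>) (L - k - i)
        / (fact (L - k - i) * (fact i * pochhammer A (k + i + k))))
      = pochhammer (A - \<rho>) L * pochhammer (A - \<sigma>) L *
      (pochhammer \<rho> k * pochhammer \<sigma> k / (pochhammer (A - \<rho>) k * pochhammer (A - \<sigma>) k) * \<alpha> k
          / (fact (L - k) * pochhammer A (L + k)))"
      unfolding inner * using A(2,3)[of k] k by (simp add: add_ac)
  qed
  finally show ?thesis by (simp add: g_def sum_distrib_left)
qed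

text \<open>Two steps along the Bailey chain from the unit pair: the first, with \<open>b\<close>
  and \<open>c\<close>, yields a \<open>\<beta>\<close> in closed form because only
  \<open>i = 0\<close> survives; the second, with \<open>d\<close> and \<open>e\<close>, is the
  identity. On the left stands a very-well-poised 7F6 whose numerator parameter \<open>-n\<close> is
  hidden in \<open>fact (n - k)\<close>, on the right a balanced 4F3.\<close>

lemma whipple_transformation:
  fixes a b c d e :: "'a::field_char_0"
  assumes a: "\<And>m. pochhammer a m \<noteq> 0"
    and nz: "\<And>m. pochhammer (1 + a - b) m \<noteq> 0" "\<And>m. pochhammer (1 + a - c) m \<noteq> 0"
      "\<And>m. pochhammer (1 + a - d) m \<noteq> 0" "\<And>m. pochhammer (1 + a - e) m \<noteq> 0"
  shows "pochhammer (1 + a - d) n * pochhammer (1 + a - e) n *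
      (\<Sum>k\<le>n. pochhammer b k * pochhammer c k * pochhammer d k * pochhammer e k
         / (pochhammer (1 + a - b) k * pochhammer (1 + a - c) k * pochhammer (1 + a - d) k * pochhammer (1 + a - e) k)
         * ((-1) ^ k * pochhammer a k * (a + 2 * of_nat k) / (fact k * (fact (n - k) * pochhammer a (Suc (n + k))))))
    = (\<Sum>j\<le>n. pochhammer d j * pochhammer e j * pochhammer (1 + a - d - e) (n - j) * pochhammer (1 + a - b - c) j
         / (fact (n - j) * fact j * pochhammer (1 + a - b) j * pochhammer (1 + a - c) j))"
proof -
  define \<alpha> where "\<alpha> k = (-1) ^ k * pochhammer a k * (a + 2 * of_nat k) / (a * fact k)" for k
  define \<alpha>1 where "\<alpha>1 k = pochhammer b k * pochhammer c k / (pochhammer (1 + a - b) k * pochhammer (1 + a - c) k) * \<alpha> k" for k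
  define \<beta>1 where "\<beta>1 j = pochhammer (1 + a - b - c) j / (fact j * pochhammer (1 + a - b) j * pochhammer (1 + a - c) j)" for j
  have a0: "a \<noteq> 0" using a[of 1] by simp
  have A: "pochhammer a (Suc m) = a * pochhammer (1 + a) m" for m
    by (simp add: pochhammer_rec add.commute)
  have Anz: "pochhammer (1 + a) m \<noteq> 0" for m
    using a[of "Suc m"] unfolding A by simp
  have \<alpha>_eq: "\<alpha> k / (x * pochhammer (1 + a) m) = (-1) ^ k * pochhammer a k * (a + 2 * of_nat k) / (fact k * (x * pochhammer a (Suc m)))"
    for k m x unfolding A \<alpha>_def by (simp add: mult_ac)
  have "(if j = 0 then 1 else 0) = (\<Sum>k\<le>j. \<alpha> k / (fact (j - k) * pochhammer (1 + a) (j + k)))" for j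
    unfolding \<alpha>_eq using unit_bailey_pair[OF a, of j] by simp
  note step1 = bailey_lemma[OF Anz nz(1,2) this]
  have "\<beta>1 j = (\<Sum>k\<le>j. \<alpha>1 k / (fact (j - k) * pochhammer (1 + a) (j + k)))" for j
  proof -
    have "(\<Sum>i\<le>j. pochhammer b i * pochhammer c i * pochhammer (1 + a - b - c) (j - i) / fact (j - i) * (if i = 0 then 1 else 0))
       = (\<Sum>i\<le>j. if i = 0 then pochhammer (1 + a - b - c) j / fact j else 0)"
      by (intro sum.cong refl) auto
    also have "\<dots> = pochhammer (1 + a - b - c) j / fact j"
      by simp
    finally show ?thesis using step1[of j] nz(1,2)[of j]
      by (simp add: \<beta>1_def \<alpha>1_def divide_simps mult_ac)
  qed
  from bailey_lemma[OF Anz nz(3,4) this, of n]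
  have "pochhammer (1 + a - d) n * pochhammer (1 + a - e) n *
      (\<Sum>k\<le>n. pochhammer d k * pochhammer e k / (pochhammer (1 + a - d) k * pochhammer (1 + a - e) k) * \<alpha>1 k
          / (fact (n - k) * pochhammer (1 + a) (n + k)))
    = (\<Sum>j\<le>n. pochhammer d j * pochhammer e j * pochhammer (1 + a - d - e) (n - j) / fact (n - j) * \<beta>1 j)"
    by (rule sym)
  also have "(\<Sum>k\<le>n. pochhammer d k * pochhammer e k / (pochhammer (1 + a - d) k * pochhammer (1 + a - e) k) * \<alpha>1 k
          / (fact (n - k) * pochhammer (1 + a) (n + k)))
     = (\<Sum>k\<le>n. pochhammer b k * pochhammer c k * pochhammer d k * pochhammer e k
         / (pochhammer (1 + a - b) k * pochhammer (1 + a - c) k * pochhammer (1 + a - d) k * pochhammer (1 + a - e) k)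
         * (\<alpha> k / (fact (n - k) * pochhammer (1 + a) (n + k))))"
    by (intro sum.cong refl) (simp add: \<alpha>1_def mult_ac)
  finally show ?thesis unfolding \<alpha>_eq \<beta>1_def by (simp add: mult_ac)
qed

text \<open>The factors \<open>pochhammer w (n - j)\<close> stand for the denominators \<open>(1 - w - n)\<^sub>j\<close> of the usual
  formulation, so nothing has to be assumed about the vanishing of the latter.\<close>
lemma sears_transformation:
  fixes b c d e :: "'a::field_char_0"
  assumes nz: "\<And>m. pochhammer u m \<noteq> 0" "\<And>m. pochhammer v m \<noteq> 0"
    and bal: "u + v = d + e + g + w"
  shows "pochhammer u n * pochhammer v n *
     (\<Sum>j\<le>n. pochhammer d j * pochhammer e j * pochhammer w (n - j) * pochhammer g j
         / (fact (n - j) * fact j * pochhammer u j * pochhammer v j))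
   = (\<Sum>i\<le>n. pochhammer d i * pochhammer (1 - w - of_nat n - e) i * pochhammer (1 - w - of_nat n - g) i
         * pochhammer w (n - i) * pochhammer (u - d) (n - i) * pochhammer (v - d) (n - i)
         / (fact i * fact (n - i)))"
proof -
  \<comment> \<open>\<open>F\<close> is the bottom parameter hidden in
    \<open>pochhammer w (n - j)\<close>; expanding \<open>(e)_j (g)_j\<close> around it replaces
    \<open>e\<close> and \<open>g\<close> by \<open>F - e\<close> and \<open>F - g\<close>.\<close>
  define F where "F = 1 - w - of_nat n"
  define G where "G = e + g - F"
  have expand: "pochhammer e j * pochhammer g j = (\<Sum>i\<le>j. of_nat (j choose i) * pochhammer (F - e) i * pochhammer (F - g) i
        * pochhammer (F + of_nat i) (j - i) * pochhammer G (j - i))" for j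
    unfolding G_def by (rule saalschuetz)
  have "(\<Sum>j\<le>n. pochhammer d j * pochhammer e j * pochhammer w (n - j) * pochhammer g j
         / (fact (n - j) * fact j * pochhammer u j * pochhammer v j))
     = (\<Sum>j\<le>n. \<Sum>i\<le>j. pochhammer d j * pochhammer w (n - j) / (fact (n - j) * fact j * pochhammer u j * pochhammer v j)
         * (of_nat (j choose i) * pochhammer (F - e) i * pochhammer (F - g) i
        * pochhammer (F + of_nat i) (j - i) * pochhammer G (j - i)))"
    unfolding sum_distrib_left[symmetric] expand[symmetric]
    by (intro sum.cong refl) (simp add: mult_ac)
  also have "\<dots> = (\<Sum>i\<le>n. \<Sum>m\<le>n - i. pochhammer d (i + m) * pochhammer w (n - (i + m)) / (fact (n - (i + m)) * fact (i + m) * pochhammer u (i + m) * pochhammer v (i + m))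
         * (of_nat (i + m choose i) * pochhammer (F - e) i * pochhammer (F - g) i
        * pochhammer (F + of_nat i) (i + m - i) * pochhammer G (i + m - i)))"
    by (rule sum_triangle_shift)
  also have "\<dots> = (\<Sum>i\<le>n. pochhammer (F - e) i * pochhammer (F - g) i * pochhammer w (n - i) * pochhammer d i
       / (fact i * fact (n - i) * pochhammer u n * pochhammer v n) *
      (\<Sum>m\<le>n - i. (-1) ^ m * of_nat (n - i choose m) * pochhammer (d + of_nat i) m * pochhammer G m
         * pochhammer (u + of_nat i + of_nat m) (n - i - m) * pochhammer (v + of_nat i + of_nat m) (n - i - m)))"
    unfolding sum_distrib_left
  proof (intro sum.cong refl)
    fix i m assume "i \<in> {..n}" "m \<in> {..n - i}"
    then obtain l where n: "n = i + m + l"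
      by (metis add.assoc atMost_iff le_Suc_ex le_add_diff_inverse)
    \<comment> \<open>The factor \<open>(F + i)_m\<close> of the expansion completes
      \<open>(w)_(n-i-m)\<close> to \<open>(w)_(n-i)\<close> up to sign, which can then be pulled
      out of the inner sum.\<close>
    have w: "pochhammer w (n - i) = pochhammer w (n - (i + m)) * ((-1) ^ m * pochhammer (F + of_nat i) m)"
    proof -
      have "pochhammer w (n - i) = pochhammer w l * pochhammer (w + of_nat l) m"
        using pochhammer_product'[of w l m] n by (simp add: add.commute)
      also have "pochhammer (w + of_nat l) m = (-1) ^ m * pochhammer (1 - (w + of_nat l) - of_nat m) m"
        by (rule pochhammer_reflect)
      also have "1 - (w + of_nat l) - of_nat m = F + of_nat i"
        by (simp add: F_def n)
      finally show ?thesis using n by simp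
    qed
    have bin: "of_nat (i + m choose i) / fact (i + m) = (1 / (fact i * fact m) :: 'a)"
      by (subst binomial_fact) simp_all
    have bin2: "of_nat (n - i choose m) / fact (n - i) = (1 / (fact m * fact l) :: 'a)"
      by (subst binomial_fact) (simp_all add: n)
    have sq: "((-1) ^ m * (-1) ^ m :: 'a) = 1"
      by (simp flip: power_mult_distrib)
    have uv: "pochhammer u n = pochhammer u (i + m) * pochhammer (u + of_nat i + of_nat m) l"
      "pochhammer v n = pochhammer v (i + m) * pochhammer (v + of_nat i + of_nat m) l"
      using pochhammer_product'[of u "i + m" l] pochhammer_product'[of v "i + m" l] by (simp_all add: n add_ac)
    have "pochhammer (u + of_nat i + of_nat m) l \<noteq> 0" "pochhammer (v + of_nat i + of_nat m) l \<noteq> 0"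
      using nz[of n] unfolding uv by simp_all
    then have uv': "pochhammer (u + of_nat i + of_nat m) l / pochhammer u n = 1 / pochhammer u (i + m)"
      "pochhammer (v + of_nat i + of_nat m) l / pochhammer v n = 1 / pochhammer v (i + m)"
      unfolding uv by simp_all
    have dd: "pochhammer d (i + m) = pochhammer d i * pochhammer (d + of_nat i) m"
      by (rule pochhammer_product')
    have nim: "n - i - m = l" "n - (i + m) = l" "i + m - i = m" using n by simp_all
    have "pochhammer (F - e) i * pochhammer (F - g) i * pochhammer w (n - i) * pochhammer d i
       / (fact i * fact (n - i) * pochhammer u n * pochhammer v n) *
      ((-1) ^ m * of_nat (n - i choose m) * pochhammer (d + of_nat i) m * pochhammer G m
         * pochhammer (u + of_nat i + of_nat m) (n - i - m) * pochhammer (v + of_nat i + of_nat m) (n - i - m))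
     = pochhammer (F - e) i * pochhammer (F - g) i * (pochhammer d i * pochhammer (d + of_nat i) m) * pochhammer G m / fact i
       * ((-1) ^ m * pochhammer w (n - i)) * (of_nat (n - i choose m) / fact (n - i))
       * (pochhammer (u + of_nat i + of_nat m) l / pochhammer u n) * (pochhammer (v + of_nat i + of_nat m) l / pochhammer v n)"
      unfolding nim by (simp add: mult_ac)
    also have "(-1) ^ m * pochhammer w (n - i) = pochhammer w l * pochhammer (F + of_nat i) m"
      using sq unfolding w nim by (simp add: mult.assoc[symmetric])
    also have "pochhammer (F - e) i * pochhammer (F - g) i * (pochhammer d i * pochhammer (d + of_nat i) m) * pochhammer G m / fact i
       * (pochhammer w l * pochhammer (F + of_nat i) m) * (of_nat (n - i choose m) / fact (n - i))
       * (pochhammer (u + of_nat i + of_nat m) l / pochhammer u n) * (pochhammer (v + of_nat i + of_nat m) l / pochhammer v n)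
      = pochhammer d (i + m) * pochhammer w l / (fact l * pochhammer u (i + m) * pochhammer v (i + m))
         * ((1 / (fact i * fact m)) * pochhammer (F - e) i * pochhammer (F - g) i
        * pochhammer (F + of_nat i) m * pochhammer G m)"
      unfolding uv' bin2 dd by (simp add: mult_ac)
    also have "\<dots> = pochhammer d (i + m) * pochhammer w (n - (i + m)) / (fact (n - (i + m)) * fact (i + m) * pochhammer u (i + m) * pochhammer v (i + m))
         * (of_nat (i + m choose i) * pochhammer (F - e) i * pochhammer (F - g) i
        * pochhammer (F + of_nat i) (i + m - i) * pochhammer G (i + m - i))"
      unfolding bin[symmetric] nim by (simp add: mult_ac)
    finally show "pochhammer d (i + m) * pochhammer w (n - (i + m)) / (fact (n - (i + m)) * fact (i + m) * pochhammer u (i + m) * pochhammer v (i + m))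
         * (of_nat (i + m choose i) * pochhammer (F - e) i * pochhammer (F - g) i
        * pochhammer (F + of_nat i) (i + m - i) * pochhammer G (i + m - i))
      = pochhammer (F - e) i * pochhammer (F - g) i * pochhammer w (n - i) * pochhammer d i
       / (fact i * fact (n - i) * pochhammer u n * pochhammer v n) *
      ((-1) ^ m * of_nat (n - i choose m) * pochhammer (d + of_nat i) m * pochhammer G m
         * pochhammer (u + of_nat i + of_nat m) (n - i - m) * pochhammer (v + of_nat i + of_nat m) (n - i - m))"
      by (rule sym)
  qed
  also have "\<dots> = (\<Sum>i\<le>n. pochhammer (F - e) i * pochhammer (F - g) i * pochhammer w (n - i) * pochhammer d i
       / (fact i * fact (n - i) * pochhammer u n * pochhammer v n) *
       (pochhammer (u - d) (n - i) * pochhammer (v - d) (n - i)))"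
  proof (intro sum.cong refl)
    fix i assume i: "i \<in> {..n}"
    \<comment> \<open>The hypothesis \<open>bal\<close> makes every inner sum balanced, whatever
      \<open>i\<close> is.\<close>
    have "(u + of_nat i) + (v + of_nat i) = (d + of_nat i) + G + 1 - of_nat (n - i)"
      using i bal by (simp add: of_nat_diff G_def F_def algebra_simps)
    from saalschuetz_balanced[OF this]
    show "pochhammer (F - e) i * pochhammer (F - g) i * pochhammer w (n - i) * pochhammer d i
       / (fact i * fact (n - i) * pochhammer u n * pochhammer v n) *
      (\<Sum>m\<le>n - i. (-1) ^ m * of_nat (n - i choose m) * pochhammer (d + of_nat i) m * pochhammer G m
         * pochhammer (u + of_nat i + of_nat m) (n - i - m) * pochhammer (v + of_nat i + of_nat m) (n - i - m))
      = pochhammer (F - e) i * pochhammer (F - g) i * pochhammer w (n - i) * pochhammer d i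
       / (fact i * fact (n - i) * pochhammer u n * pochhammer v n) *
       (pochhammer (u - d) (n - i) * pochhammer (v - d) (n - i))"
      by simp
  qed
  finally show ?thesis
    using nz[of n] by (simp add: sum_distrib_left F_def mult_ac)
qed

text \<open>The composition singles out \<open>d\<close>: it is paired with each of
  \<open>b\<close>, \<open>c\<close>, \<open>e\<close> in a numerator factor of length
  \<open>n - i\<close>. These three factors later supply \<open>p^3\<close>.\<close>

lemma well_poised_transformation:
  fixes a b c d e :: "'a::field_char_0"
  assumes a: "\<And>m. pochhammer a m \<noteq> 0"
    and nz: "\<And>m. pochhammer (1 + a - b) m \<noteq> 0" "\<And>m. pochhammer (1 + a - c) m \<noteq> 0"
      "\<And>m. pochhammer (1 + a - d) m \<noteq> 0" "\<And>m. pochhammer (1 + a - e) m \<noteq> 0"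
  shows "pochhammer (1 + a - b) n * pochhammer (1 + a - c) n * pochhammer (1 + a - d) n * pochhammer (1 + a - e) n *
      (\<Sum>k\<le>n. pochhammer b k * pochhammer c k * pochhammer d k * pochhammer e k
         / (pochhammer (1 + a - b) k * pochhammer (1 + a - c) k * pochhammer (1 + a - d) k * pochhammer (1 + a - e) k)
         * ((-1) ^ k * pochhammer a k * (a + 2 * of_nat k) / (fact k * (fact (n - k) * pochhammer a (Suc (n + k))))))
    = (\<Sum>i\<le>n. pochhammer d i * pochhammer (d - a - of_nat n) i * pochhammer (b + c + d + e - 2 * a - 1 - of_nat n) i
         * pochhammer (1 + a - d - e) (n - i) * pochhammer (1 + a - b - d) (n - i) * pochhammer (1 + a - c - d) (n - i)
         / (fact i * fact (n - i)))"
proof -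
  have "(1 + a - b) + (1 + a - c) = d + e + (1 + a - b - c) + (1 + a - d - e)" by simp
  note sears_transformation[OF nz(1,2) this, of n]
  moreover have "1 - (1 + a - d - e) - of_nat n - e = d - a - of_nat n"
    "1 - (1 + a - d - e) - of_nat n - (1 + a - b - c) = b + c + d + e - 2 * a - 1 - of_nat n"
    by (simp_all add: algebra_simps)
  ultimately show ?thesis
    using whipple_transformation[OF a nz, of n] by (simp only: mult.assoc)
qed

section \<open>Congruences in the fifth cyclotomic ring localised at p\<close>

definition zeta5 :: complex where
  "zeta5 = cis (2 * pi / 5)"

lemma zeta5_pow: "zeta5 ^ 5 = 1"
  by (simp add: zeta5_def DeMoivre)

lemma zeta5_neq_1: "zeta5 \<noteq> 1"
proof
  assume "zeta5 = 1"
  then have "cos (2 * pi / 5) = 1" by (simp add: zeta5_def complex_eq_iff)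
  moreover have "cos (2 * pi / 5) < cos 0"
    by (rule cos_monotone_0_pi) (auto simp: field_simps)
  ultimately show False by simp
qed

lemma zeta5_pow4: "zeta5 ^ 4 = - 1 - zeta5 - zeta5 ^ 2 - zeta5 ^ 3"
proof -
  have "(zeta5 - 1) * (1 + zeta5 + zeta5 ^ 2 + zeta5 ^ 3 + zeta5 ^ 4) = zeta5 ^ 5 - 1"
    by Groebner_Basis.algebra
  then have "1 + zeta5 + zeta5 ^ 2 + zeta5 ^ 3 + zeta5 ^ 4 = 0"
    using zeta5_neq_1 by (simp add: zeta5_pow)
  then show ?thesis by Groebner_Basis.algebra
qed

lemma cnj_zeta5: "cnj zeta5 = zeta5 ^ 4"
proof -
  have "cnj zeta5 * zeta5 = 1"
    by (simp add: zeta5_def cis_cnj cis_mult)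
  then show ?thesis using zeta5_pow by Groebner_Basis.algebra
qed

text \<open>Parity suffices: for \<open>w = a / b\<close> in lowest terms,
  \<open>a^2 + a b = b^2\<close> forces \<open>a\<close> and \<open>b\<close> both to be
  even.\<close>

lemma golden_ratio_irrational:
  fixes w :: "'a::field_char_0"
  assumes "w ^ 2 + w = 1"
  shows "w \<notin> \<rat>"
proof
  assume "w \<in> \<rat>"
  then obtain a b :: int where ab: "b > 0" "coprime a b" "w = of_int a / of_int b"
    by (elim Rats_cases') auto
  then have "(of_int (a * a + a * b) :: 'a) = of_int (b * b)"
  proof -
    have a: "of_int a = w * of_int b" using ab by simp
    have "of_int (a * a + a * b) = of_int b * of_int b * (w ^ 2 + w)"
      by (simp add: a algebra_simps power2_eq_square)
    then show ?thesis using assms by simp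
  qed
  then have eq: "a * a + a * b = b * b"
    by (simp only: of_int_eq_iff)
  have "even (a * a + a * b) \<longleftrightarrow> even (b * b)" using eq by simp
  then have "even a \<and> even b" by auto
  then show False using \<open>coprime a b\<close> by (metis coprime_common_divisor odd_one)
qed

locale prime_number =
  fixes p :: nat
  assumes prime_p: "prime p"
begin

text \<open>\<open>Zloc\<close> is $\mathbb{Z}_{(p)}$ and \<open>Rcyc\<close> is $\mathbb{Z}_{(p)}[\zeta_5]$; both live inside the complex numbers,
  so that the transformation formulas can be used there with division.\<close>
definition Zloc :: "complex set" where
  "Zloc = {of_int a / of_int b | a b. \<not> int p dvd b}"

definition Rcyc :: "complex set" where
  "Rcyc = {c0 + c1 * zeta5 + c2 * zeta5 ^ 2 + c3 * zeta5 ^ 3 | c0 c1 c2 c3.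
     c0 \<in> Zloc \<and> c1 \<in> Zloc \<and> c2 \<in> Zloc \<and> c3 \<in> Zloc}"

lemma prime_int_p: "prime (int p)"
  using prime_p by simp

lemma Zloc_I: "\<not> int p dvd b \<Longrightarrow> of_int a / of_int b \<in> Zloc"
  unfolding Zloc_def by blast

lemma Zloc_of_int [simp]: "of_int a \<in> Zloc"
  using Zloc_I[of 1 a] prime_int_p not_prime_unit by auto

lemma Zloc_0 [simp]: "0 \<in> Zloc" and Zloc_1 [simp]: "1 \<in> Zloc"
  using Zloc_of_int[of 0] Zloc_of_int[of 1] by simp_all

lemma Zloc_add [intro]: "x \<in> Zloc \<Longrightarrow> y \<in> Zloc \<Longrightarrow> x + y \<in> Zloc"
  and Zloc_mult [intro]: "x \<in> Zloc \<Longrightarrow> y \<in> Zloc \<Longrightarrow> x * y \<in> Zloc"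
proof -
  assume "x \<in> Zloc" "y \<in> Zloc"
  then obtain a b c d where x: "x = of_int a / of_int b" "\<not> int p dvd b"
    and y: "y = of_int c / of_int d" "\<not> int p dvd d"
    unfolding Zloc_def by blast
  have bd: "\<not> int p dvd b * d" "b \<noteq> 0" "d \<noteq> 0"
    using x y by (auto simp: prime_dvd_mult_iff[OF prime_int_p])
  have "x + y = of_int (a * d + c * b) / of_int (b * d)"
    using x y bd by (simp add: add_frac_eq)
  then show "x + y \<in> Zloc" using bd Zloc_I by metis
  have "x * y = of_int (a * c) / of_int (b * d)"
    using x y by simp
  then show "x * y \<in> Zloc" using bd Zloc_I by metis
qed

lemma Zloc_uminus [intro]: "x \<in> Zloc \<Longrightarrow> - x \<in> Zloc"
  using Zloc_mult[OF Zloc_of_int[of "- 1"], of x] by simp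

lemma Zloc_diff [intro]: "x \<in> Zloc \<Longrightarrow> y \<in> Zloc \<Longrightarrow> x - y \<in> Zloc"
  using Zloc_add[of x "- y"] by auto

lemma Zloc_Rats: "x \<in> Zloc \<Longrightarrow> x \<in> \<rat>"
  unfolding Zloc_def by auto

lemma Rcyc_I: "c0 \<in> Zloc \<Longrightarrow> c1 \<in> Zloc \<Longrightarrow> c2 \<in> Zloc \<Longrightarrow> c3 \<in> Zloc \<Longrightarrow>
  x = c0 + c1 * zeta5 + c2 * zeta5 ^ 2 + c3 * zeta5 ^ 3 \<Longrightarrow> x \<in> Rcyc"
  unfolding Rcyc_def by blast

lemma Zloc_Rcyc [intro]: "x \<in> Zloc \<Longrightarrow> x \<in> Rcyc"
  by (rule Rcyc_I[of x 0 0 0]) simp_all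

lemma Rcyc_zeta5 [simp]: "zeta5 \<in> Rcyc"
  by (rule Rcyc_I[of 0 1 0 0]) simp_all

lemma Rcyc_add [intro]:
  assumes "x \<in> Rcyc" "y \<in> Rcyc"
  shows "x + y \<in> Rcyc"
proof -
  obtain a0 a1 a2 a3 b0 b1 b2 b3 where
    "x = a0 + a1 * zeta5 + a2 * zeta5 ^ 2 + a3 * zeta5 ^ 3" "a0 \<in> Zloc" "a1 \<in> Zloc" "a2 \<in> Zloc" "a3 \<in> Zloc"
    "y = b0 + b1 * zeta5 + b2 * zeta5 ^ 2 + b3 * zeta5 ^ 3" "b0 \<in> Zloc" "b1 \<in> Zloc" "b2 \<in> Zloc" "b3 \<in> Zloc"
    using assms unfolding Rcyc_def by blast
  then show ?thesis
    by (intro Rcyc_I[of "a0 + b0" "a1 + b1" "a2 + b2" "a3 + b3"] Zloc_add) (simp_all add: algebra_simps)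
qed

lemma Rcyc_mult [intro]:
  assumes "x \<in> Rcyc" "y \<in> Rcyc"
  shows "x * y \<in> Rcyc"
proof -
  obtain a0 a1 a2 a3 b0 b1 b2 b3 where
    x: "x = a0 + a1 * zeta5 + a2 * zeta5 ^ 2 + a3 * zeta5 ^ 3" and a: "a0 \<in> Zloc" "a1 \<in> Zloc" "a2 \<in> Zloc" "a3 \<in> Zloc"
    and y: "y = b0 + b1 * zeta5 + b2 * zeta5 ^ 2 + b3 * zeta5 ^ 3" and b: "b0 \<in> Zloc" "b1 \<in> Zloc" "b2 \<in> Zloc" "b3 \<in> Zloc"
    using assms unfolding Rcyc_def by blast
  \<comment> \<open>The coefficient of \<open>zeta5 ^ 4\<close> in the product, to be spread over
    the lower powers by \<open>zeta5_pow4\<close>.\<close>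
  let ?d4 = "a1 * b3 + a2 * b2 + a3 * b1"
  show ?thesis
  proof (rule Rcyc_I)
    show "x * y = (a0 * b0 + (a2 * b3 + a3 * b2) - ?d4)
      + (a0 * b1 + a1 * b0 + a3 * b3 - ?d4) * zeta5
      + (a0 * b2 + a1 * b1 + a2 * b0 - ?d4) * zeta5 ^ 2
      + (a0 * b3 + a1 * b2 + a2 * b1 + a3 * b0 - ?d4) * zeta5 ^ 3"
      unfolding x y using zeta5_pow4 zeta5_pow by Groebner_Basis.algebra
  qed (intro Zloc_diff Zloc_add Zloc_mult a b)+
qed

lemma Rcyc_of_int [simp]: "of_int a \<in> Rcyc"
  by auto

lemma Rcyc_basic [simp]: "0 \<in> Rcyc" "1 \<in> Rcyc" "of_nat m \<in> Rcyc" "numeral k \<in> Rcyc" "fact m \<in> Rcyc"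
  using Rcyc_of_int[of 0] Rcyc_of_int[of 1] Rcyc_of_int[of "int m"] Rcyc_of_int[of "numeral k"]
    Rcyc_of_int[of "fact m"]
  by (simp_all del: Rcyc_of_int)

lemma Rcyc_uminus [intro]: "x \<in> Rcyc \<Longrightarrow> - x \<in> Rcyc"
  using Rcyc_mult[OF Rcyc_of_int[of "- 1"], of x] by simp

lemma Rcyc_diff [intro]: "x \<in> Rcyc \<Longrightarrow> y \<in> Rcyc \<Longrightarrow> x - y \<in> Rcyc"
  using Rcyc_add[of x "- y"] by auto

lemma Rcyc_power [intro]: "x \<in> Rcyc \<Longrightarrow> x ^ m \<in> Rcyc"
  by (induction m) auto

lemma Rcyc_sum: "(\<And>i. i \<in> A \<Longrightarrow> f i \<in> Rcyc) \<Longrightarrow> sum f A \<in> Rcyc"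
  by (induction A rule: infinite_finite_induct) auto

lemma Rcyc_prod: "(\<And>i. i \<in> A \<Longrightarrow> f i \<in> Rcyc) \<Longrightarrow> prod f A \<in> Rcyc"
  by (induction A rule: infinite_finite_induct) auto

lemma Rcyc_pochhammer [intro]: "x \<in> Rcyc \<Longrightarrow> pochhammer x m \<in> Rcyc"
  by (auto simp: pochhammer_prod intro!: Rcyc_prod)

lemma Rcyc_divide_int: "x \<in> Rcyc \<Longrightarrow> \<not> int p dvd b \<Longrightarrow> x / of_int b \<in> Rcyc"
  using Rcyc_mult[of x "of_int 1 / of_int b"] Zloc_I[of b 1] by auto

text \<open>Complex conjugation and the irrationality of \<open>zeta5 + zeta5 ^ 4\<close> replace the linear independence
  of the powers of \<open>zeta5\<close>.\<close>
lemma Rcyc_Rats: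
  assumes "x \<in> Rcyc" "x \<in> \<rat>"
  shows "x \<in> Zloc"
proof -
  obtain c0 c1 c2 c3 where x: "x = c0 + c1 * zeta5 + c2 * zeta5 ^ 2 + c3 * zeta5 ^ 3"
    and c: "c0 \<in> Zloc" "c1 \<in> Zloc" "c2 \<in> Zloc" "c3 \<in> Zloc"
    using assms unfolding Rcyc_def by blast
  define w where "w = zeta5 + zeta5 ^ 4"
  have w: "w \<notin> \<rat>"
    by (rule golden_ratio_irrational) (use zeta5_pow4 zeta5_pow in \<open>unfold w_def; Groebner_Basis.algebra\<close>)
  have cnj_rat: "cnj y = y" if "y \<in> \<rat>" for y
    using that by (auto elim!: Rats_cases')
  have cnjs: "cnj x = x" "cnj c0 = c0" "cnj c1 = c1" "cnj c2 = c2" "cnj c3 = c3"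
    using c[THEN Zloc_Rats] assms(2) cnj_rat by auto
  have "cnj x = c0 + c1 * zeta5 ^ 4 + c2 * (zeta5 ^ 4) ^ 2 + c3 * (zeta5 ^ 4) ^ 3"
    unfolding x by (simp add: cnjs cnj_zeta5)
  then have x': "x = c0 + c1 * zeta5 ^ 4 + c2 * (zeta5 ^ 4) ^ 2 + c3 * (zeta5 ^ 4) ^ 3"
    using cnjs by simp
  \<comment> \<open>Subtract the conjugate expression from \<open>x\<close>; the factorisation uses
    \<open>zeta5 ^ 2 - zeta5 ^ 3 = (zeta5 - zeta5 ^ 4) * w\<close>.\<close>
  have "(zeta5 - zeta5 ^ 4) * (c1 + (c2 - c3) * w) = 0"
    using x x' zeta5_pow unfolding w_def by Groebner_Basis.algebra
  moreover have "zeta5 - zeta5 ^ 4 \<noteq> 0"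
  proof
    assume "zeta5 - zeta5 ^ 4 = 0"
    then have "zeta5 = 1" using zeta5_pow by Groebner_Basis.algebra
    then show False using zeta5_neq_1 by simp
  qed
  ultimately have 1: "c1 + (c2 - c3) * w = 0" by simp
  have "c2 = c3"
  proof (rule ccontr)
    assume "c2 \<noteq> c3"
    then have "w = - c1 / (c2 - c3)" using 1 by (simp add: field_simps add_eq_0_iff)
    moreover have "- c1 / (c2 - c3) \<in> \<rat>" using c[THEN Zloc_Rats] by simp
    ultimately show False using w by simp
  qed
  moreover from this have c1: "c1 = 0" using 1 by simp
  ultimately have 2: "x = c0 - c2 - c2 * w"
    using x by (simp add: w_def zeta5_pow4 algebra_simps)
  have "c2 = 0"
  proof (rule ccontr)
    assume "c2 \<noteq> 0"
    then have "w = (c0 - c2 - x) / c2" using 2 by (simp add: field_simps)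
    moreover have "(c0 - c2 - x) / c2 \<in> \<rat>" using c[THEN Zloc_Rats] assms(2) by simp
    ultimately show False using w by simp
  qed
  then show ?thesis using 2 c by simp
qed

text \<open>Only the difference has to be a multiple of \<open>p^N\<close> in the ring; the
  arguments themselves may be any complex numbers. Membership in \<open>Rcyc\<close> is therefore
  demanded separately where products are formed.\<close>

definition ring_cong :: "nat \<Rightarrow> complex \<Rightarrow> complex \<Rightarrow> bool" where
  "ring_cong N x y \<longleftrightarrow> (\<exists>w\<in>Rcyc. x - y = of_nat p ^ N * w)"

lemma ring_cong_refl [simp, intro]: "ring_cong N x x"
  unfolding ring_cong_def by (intro bexI[of _ 0]) simp_all

lemma ring_cong_sym: "ring_cong N x y \<Longrightarrow> ring_cong N y x"
  unfolding ring_cong_def by (metis Rcyc_uminus minus_diff_eq mult_minus_right)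

lemma ring_cong_add: "ring_cong N x y \<Longrightarrow> ring_cong N x' y' \<Longrightarrow> ring_cong N (x + x') (y + y')"
proof -
  assume "ring_cong N x y" "ring_cong N x' y'"
  then obtain w w' where "w \<in> Rcyc" "w' \<in> Rcyc" "x - y = of_nat p ^ N * w" "x' - y' = of_nat p ^ N * w'"
    unfolding ring_cong_def by blast
  then show ?thesis unfolding ring_cong_def
    by (intro bexI[of _ "w + w'"]) (auto simp: algebra_simps)
qed

lemma ring_cong_trans [trans]: "ring_cong N x y \<Longrightarrow> ring_cong N y z \<Longrightarrow> ring_cong N x z"
  using ring_cong_add[of N x y y z] by (auto simp: ring_cong_def)

lemma ring_cong_mult: "ring_cong N x y \<Longrightarrow> ring_cong N x' y' \<Longrightarrow> x' \<in> Rcyc \<Longrightarrow> y \<in> Rcyc \<Longrightarrow> ring_cong N (x * x') (y * y')"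
proof -
  assume "ring_cong N x y" "ring_cong N x' y'" and R: "x' \<in> Rcyc" "y \<in> Rcyc"
  then obtain w w' where "w \<in> Rcyc" "w' \<in> Rcyc" "x - y = of_nat p ^ N * w" "x' - y' = of_nat p ^ N * w'"
    unfolding ring_cong_def by blast
  moreover have "x * x' - y * y' = (x - y) * x' + y * (x' - y')" by (simp add: algebra_simps)
  ultimately have "x * x' - y * y' = of_nat p ^ N * (w * x' + y * w')"
    by (simp add: algebra_simps)
  moreover have "w * x' + y * w' \<in> Rcyc"
    using R \<open>w \<in> Rcyc\<close> \<open>w' \<in> Rcyc\<close> by blast
  ultimately show ?thesis unfolding ring_cong_def by blast
qed

lemma ring_cong_uminus: "ring_cong N x y \<Longrightarrow> ring_cong N (- x) (- y)"
  using ring_cong_mult[of N "of_int (-1)" "of_int (-1)" x y]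
  unfolding ring_cong_def by (metis Rcyc_uminus minus_diff_commute minus_diff_eq mult_minus_right uminus_add_conv_diff diff_minus_eq_add)

lemma ring_cong_diff: "ring_cong N x y \<Longrightarrow> ring_cong N x' y' \<Longrightarrow> ring_cong N (x - x') (y - y')"
  using ring_cong_add[of N x y "- x'" "- y'"] ring_cong_uminus by auto

lemma ring_cong_prod:
  assumes "\<And>i. i \<in> A \<Longrightarrow> ring_cong N (f i) (g i) \<and> f i \<in> Rcyc \<and> g i \<in> Rcyc"
  shows "ring_cong N (prod f A) (prod g A)"
  using assms
  by (induction A rule: infinite_finite_induct) (auto intro!: ring_cong_mult Rcyc_prod)

lemma ring_cong_sum:
  assumes "\<And>i. i \<in> A \<Longrightarrow> ring_cong N (f i) (g i)"
  shows "ring_cong N (sum f A) (sum g A)"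
  using assms
  by (induction A rule: infinite_finite_induct) (auto intro!: ring_cong_add)

lemma ring_cong_power:
  assumes "ring_cong N x y" "x \<in> Rcyc" "y \<in> Rcyc"
  shows "ring_cong N (x ^ m) (y ^ m)"
  using ring_cong_prod[of "{..<m}" N "\<lambda>_. x" "\<lambda>_. y"] assms by simp

lemma ring_cong_pochhammer:
  assumes "ring_cong N x y" "x \<in> Rcyc" "y \<in> Rcyc"
  shows "ring_cong N (pochhammer x m) (pochhammer y m)"
  unfolding pochhammer_prod using assms by (auto intro!: ring_cong_prod ring_cong_add)

lemma ring_cong_inverse:
  assumes "ring_cong N x y" "1 / x \<in> Rcyc" "1 / y \<in> Rcyc" "x \<noteq> 0" "y \<noteq> 0"
  shows "ring_cong N (1 / x) (1 / y)"
proof -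
  obtain w where w: "w \<in> Rcyc" "x - y = of_nat p ^ N * w" using assms unfolding ring_cong_def by blast
  have "1 / x - 1 / y = - ((x - y) * (1 / x) * (1 / y))"
    using assms by (simp add: field_simps)
  then have "1 / x - 1 / y = of_nat p ^ N * (- (w * (1 / x) * (1 / y)))"
    unfolding w(2) by (simp add: mult_ac)
  moreover have "- (w * (1 / x) * (1 / y)) \<in> Rcyc"
    using w(1) assms by blast
  ultimately show ?thesis unfolding ring_cong_def by blast
qed

lemma ring_cong_0I: "w \<in> Rcyc \<Longrightarrow> ring_cong N (of_nat p ^ N * w) 0"
  unfolding ring_cong_def by auto

lemma ring_cong_of_int: "[a = b] (mod int p) \<Longrightarrow> ring_cong 1 (of_int a) (of_int b)"
proof -
  assume "[a = b] (mod int p)"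
  then obtain k where "a - b = int p * k" by (auto simp: cong_iff_dvd_diff)
  then have "of_int (a - b) = (of_int (int p * k) :: complex)" by simp
  then show ?thesis unfolding ring_cong_def by (intro bexI[of _ "of_int k"]) simp_all
qed

lemma padic_integral_divide: "\<not> int p dvd b \<Longrightarrow> padic_integral p (of_int a / of_int b)"
proof -
  assume b: "\<not> int p dvd b"
  obtain c d where cd: "quotient_of (of_int a / of_int b) = (c, d)" by fastforce
  have "of_int a / of_int b = (of_int c / of_int d :: rat)" "coprime c d" "d > 0"
    using quotient_of_div[OF cd] quotient_of_coprime[OF cd] quotient_of_denom_pos[OF cd] by auto
  moreover have "b \<noteq> 0" using b by auto
  ultimately have "of_int (a * d) = (of_int (c * b) :: rat)" by (simp add: field_simps)
  then have "a * d = c * b" by (simp only: of_int_eq_iff)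
  then have "d dvd c * b" by (metis dvd_triv_right)
  then have "d dvd b" using \<open>coprime c d\<close> by (simp add: coprime_commute coprime_dvd_mult_right_iff)
  then show ?thesis unfolding padic_integral_def cd using b by (auto dest: dvd_trans)
qed

text \<open>The descent from \<open>Rcyc\<close>: the quotient of the difference by
  \<open>p^N\<close> is rational and lies in \<open>Rcyc\<close>, hence in \<open>Zloc\<close> by
  \<open>Rcyc_Rats\<close>.\<close>

lemma ring_cong_imp_padic_cong:
  assumes "ring_cong N (of_rat x) (of_rat y)"
  shows "padic_cong p N x y"
proof -
  obtain w where w: "w \<in> Rcyc" "of_rat x - of_rat y = of_nat p ^ N * w"
    using assms unfolding ring_cong_def by blast
  have p0: "p \<noteq> 0" using prime_p by auto
  then have "w = of_rat ((x - y) / of_nat p ^ N)"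
    using w(2) by (simp add: of_rat_divide of_rat_diff of_rat_power)
  then have "w \<in> Zloc" using w(1) Rcyc_Rats by simp
  then obtain a b where ab: "w = of_int a / of_int b" "\<not> int p dvd b" unfolding Zloc_def by blast
  have "of_rat (x - y) = of_nat p ^ N * (of_int a / of_int b :: complex)"
    using w ab by (simp add: of_rat_diff)
  also have "\<dots> = of_rat (of_nat p ^ N * (of_int a / of_int b))"
    by (simp add: of_rat_mult of_rat_power of_rat_divide)
  finally have "x - y = of_nat p ^ N * (of_int a / of_int b)" by (simp only: of_rat_eq_iff)
  then show ?thesis unfolding padic_cong_def using padic_integral_divide[OF ab(2)] by blast
qed

text \<open>Turns an approximation of a fraction into an integer congruence; multiplying by
  \<open>b\<close> avoids inverses modulo \<open>p\<close>.\<close>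

lemma padic_cong_nat_imp_cong:
  assumes "padic_cong p 1 (of_nat m) (of_int a / of_int b)" "b \<noteq> 0"
  shows "[b * int m = a] (mod int p)"
proof -
  obtain q where q: "padic_integral p q" "of_nat m - of_int a / of_int b = of_nat p ^ 1 * q"
    using assms unfolding padic_cong_def by blast
  obtain c d where cd: "quotient_of q = (c, d)" by fastforce
  have d: "\<not> int p dvd d" using q(1) cd by (simp add: padic_integral_def)
  then have d0: "d \<noteq> 0" by auto
  have "of_nat m - of_int a / of_int b = of_nat p * (of_int c / of_int d :: rat)"
    using q(2) quotient_of_div[OF cd] by simp
  then have "(of_int (d * (b * int m - a)) :: rat) = of_int (int p * c * b)"
    using d0 assms(2) by (simp add: field_simps)
  then have "d * (b * int m - a) = int p * c * b" by (simp only: of_int_eq_iff)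
  then have "int p dvd d * (b * int m - a)" by simp
  then have "int p dvd (b * int m - a)" using d prime_dvd_mult_iff[OF prime_int_p] by blast
  then show ?thesis by (simp add: cong_iff_dvd_diff)
qed

lemma ring_cong_mono: "ring_cong M x y \<Longrightarrow> N \<le> M \<Longrightarrow> ring_cong N x y"
proof -
  assume "ring_cong M x y" and NM: "N \<le> M"
  then obtain w where "w \<in> Rcyc" "x - y = of_nat p ^ M * w" unfolding ring_cong_def by blast
  moreover have "of_nat p ^ M = (of_nat p ^ N * of_nat p ^ (M - N) :: complex)"
    using NM by (simp flip: power_add)
  ultimately have eq: "x - y = of_nat p ^ N * (of_nat p ^ (M - N) * w)" by (simp only: mult.assoc)
  have "of_nat p ^ (M - N) * w \<in> Rcyc"
    by (rule Rcyc_mult[OF Rcyc_power[OF Rcyc_basic(3)] \<open>w \<in> Rcyc\<close>])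
  with eq show ?thesis unfolding ring_cong_def by (rule bexI)
qed

section \<open>Units of the localised ring\<close>

definition Ucyc :: "complex set" where
  "Ucyc = {x \<in> Rcyc. x \<noteq> 0 \<and> 1 / x \<in> Rcyc}"

lemma Ucyc_Rcyc [intro]: "x \<in> Ucyc \<Longrightarrow> x \<in> Rcyc"
  by (simp add: Ucyc_def)

lemma Ucyc_of_int: "\<not> int p dvd b \<Longrightarrow> of_int b \<in> Ucyc"
  using Rcyc_divide_int[of 1 b] by (auto simp: Ucyc_def)

lemma Ucyc_1 [simp]: "1 \<in> Ucyc"
  by (simp add: Ucyc_def)

lemma Ucyc_minus_1 [simp]: "- 1 \<in> Ucyc"
  using Rcyc_uminus[of 1] by (simp add: Ucyc_def)

lemma Ucyc_mult [intro]: "x \<in> Ucyc \<Longrightarrow> y \<in> Ucyc \<Longrightarrow> x * y \<in> Ucyc"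
  using Rcyc_mult[of "1 / x" "1 / y"] by (auto simp: Ucyc_def)

lemma Ucyc_power [intro]: "x \<in> Ucyc \<Longrightarrow> x ^ m \<in> Ucyc"
  by (induction m) auto

lemma Ucyc_prod: "(\<And>i. i \<in> A \<Longrightarrow> f i \<in> Ucyc) \<Longrightarrow> prod f A \<in> Ucyc"
  by (induction A rule: infinite_finite_induct) auto

lemma Rcyc_divide [intro]: "x \<in> Rcyc \<Longrightarrow> y \<in> Ucyc \<Longrightarrow> x / y \<in> Rcyc"
  using Rcyc_mult[of x "1 / y"] by (simp add: Ucyc_def)

lemma Ucyc_divide [intro]: "x \<in> Ucyc \<Longrightarrow> y \<in> Ucyc \<Longrightarrow> x / y \<in> Ucyc"
  using Rcyc_divide[of x y] Rcyc_divide[of y x] by (auto simp: Ucyc_def)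

lemma ring_cong_divide:
  assumes "ring_cong N x y" "ring_cong N x' y'" "y \<in> Rcyc" "x' \<in> Ucyc" "y' \<in> Ucyc"
  shows "ring_cong N (x / x') (y / y')"
  using ring_cong_mult[OF assms(1) ring_cong_inverse[OF assms(2)] _ assms(3)] assms(4,5)
  by (simp add: Ucyc_def)

lemma Ucyc_of_nat: "0 < b \<Longrightarrow> b < p \<Longrightarrow> of_nat b \<in> Ucyc"
  using Ucyc_of_int[of "int b"] by (simp add: nat_dvd_not_less)

lemma Ucyc_fact: "k < p \<Longrightarrow> fact k \<in> Ucyc"
  unfolding fact_prod of_nat_prod by (rule Ucyc_prod) (auto intro: Ucyc_of_nat)

section \<open>Wilson's theorem and the p-adic Gamma function\<close>

text \<open>Wilson's theorem is the case \<open>u = 0\<close>; each induction step moves the factor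
  \<open>p - (u + 1)\<close>, congruent to \<open>-(u + 1)\<close>, from the second factorial to the
  first.\<close>

lemma fact_mult_fact_cong:
  assumes "u < p"
  shows "[fact u * fact (p - 1 - u) = (-1) ^ (u + 1)] (mod int p)"
  using assms
proof (induction u)
  case 0
  then show ?case using wilson_theorem[OF prime_p] by simp
next
  case (Suc u)
  have pu: "p - 1 - u = Suc (p - 1 - Suc u)" using Suc.prems by simp
  have "[(int p - int (Suc u)) * (fact u * fact (p - 1 - Suc u)) = - int (Suc u) * (fact u * fact (p - 1 - Suc u))] (mod int p)"
    by (rule cong_scalar_right) (simp add: cong_def)
  moreover have "(int p - int (Suc u)) * (fact u * fact (p - 1 - Suc u)) = fact u * fact (p - 1 - u)"
    unfolding pu fact_Suc using Suc.prems by (simp add: of_nat_diff algebra_simps)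
  ultimately have "[- int (Suc u) * (fact u * fact (p - 1 - Suc u)) = (-1) ^ (u + 1)] (mod int p)"
    using Suc.IH Suc.prems by (metis Suc_lessD cong_sym cong_trans)
  then have "[- (- int (Suc u) * (fact u * fact (p - 1 - Suc u))) = - ((-1) ^ (u + 1))] (mod int p)"
    by (simp only: cong_minus_minus_iff)
  moreover have "- (- int (Suc u) * (fact u * fact (p - 1 - Suc u))) = fact (Suc u) * fact (p - 1 - Suc u)"
    by (simp only: fact_Suc minus_mult_left[symmetric] minus_minus mult.assoc)
  ultimately show ?case by simp
qed

lemma neg_one_power_p: "[(-1) ^ p = - 1] (mod int p)"
proof (cases "p = 2")
  case False
  then have "odd p" using prime_p prime_odd_nat[of p] prime_ge_2_nat[of p] by linarith
  then show ?thesis by simp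
qed (simp add: cong_def)

text \<open>Passing a multiple of \<open>p\<close> skips a factor but changes the sign; at that
  point the accumulated value is \<open>(-1)^p (p - 1)!\<close>, congruent to 1 by Wilson, so the
  count starts afresh. Hence modulo \<open>p\<close> only the residue of \<open>m\<close>
  matters.\<close>

lemma gamma_p_nat_cong:
  "[gamma_p_nat p (Suc m) = (-1) ^ Suc (m mod p) * fact (m mod p)] (mod int p)"
proof (induction m)
  case 0
  have "{j. 0 < j \<and> j < Suc 0 \<and> \<not> p dvd j} = {}" by auto
  then show ?case unfolding gamma_p_nat_def by (simp only: prod.empty) simp
next
  case (Suc m)
  have set: "{j. 0 < j \<and> j < Suc (Suc m) \<and> \<not> p dvd j}
      = (if p dvd Suc m then {j. 0 < j \<and> j < Suc m \<and> \<not> p dvd j}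
         else insert (Suc m) {j. 0 < j \<and> j < Suc m \<and> \<not> p dvd j})"
    by (auto simp: less_Suc_eq)
  have fin: "finite {j. 0 < j \<and> j < Suc m \<and> \<not> p dvd j}" by simp
  have rec: "gamma_p_nat p (Suc (Suc m)) = - gamma_p_nat p (Suc m) * (if p dvd Suc m then 1 else int (Suc m))"
    unfolding gamma_p_nat_def set by (simp add: fin)
  show ?case
  proof (cases "p dvd Suc m")
    case True
    have p0: "p > 0" using prime_p prime_gt_0_nat by blast
    have mp: "Suc m mod p = 0" using True by simp
    then have m: "m mod p = p - 1"
      using p0 by (metis mod_Suc diff_Suc_1 nat.distinct(1) )
    have "[gamma_p_nat p (Suc m) = (-1) ^ p * fact (p - 1)] (mod int p)"
      using Suc p0 unfolding m by simp
    moreover have "[(-1) ^ p * fact (p - 1) = (-1) ^ p * (-1)] (mod int p)"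
      by (rule cong_scalar_left) (rule wilson_theorem[OF prime_p])
    moreover have "[(-1) ^ p * (-1) = 1] (mod int p)"
      using cong_scalar_right[OF neg_one_power_p, of "-1"] by simp
    ultimately have "[gamma_p_nat p (Suc m) = 1] (mod int p)"
      using cong_trans by blast
    then show ?thesis unfolding rec mp using True by (simp add: cong_minus_minus_iff)
  next
    case False
    then have m: "Suc m mod p = Suc (m mod p)" by (auto simp: mod_Suc dvd_eq_mod_eq_0 split: if_splits)
    have "[int (Suc m) = int (Suc m mod p)] (mod int p)"
      by (simp add: cong_def zmod_int)
    from cong_mult[OF Suc this]
    have "[- (gamma_p_nat p (Suc m) * int (Suc m))
        = - ((-1) ^ Suc (m mod p) * fact (m mod p) * int (Suc m mod p))] (mod int p)"
      by (simp only: cong_minus_minus_iff)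
    then show ?thesis using False unfolding rec m by (simp add: algebra_simps)
  qed
qed

lemma gamma_p_nat_not_dvd: "m > 0 \<Longrightarrow> \<not> int p dvd gamma_p_nat p m"
proof -
  assume "m > 0"
  then obtain m' where m: "m = Suc m'" by (cases m) auto
  have p0: "p > 0" using prime_p prime_gt_0_nat by blast
  have "\<not> p dvd fact (m' mod p)"
    using prime_p p0 by (simp add: prime_dvd_fact_iff not_le)
  then have "\<not> int p dvd fact (m' mod p)"
    by (metis int_dvd_int_iff of_nat_fact)
  then have "\<not> int p dvd (-1) ^ Suc (m' mod p) * fact (m' mod p)"
    by (cases "even (m' mod p)") simp_all
  then show ?thesis
    unfolding m using cong_dvd_iff[OF gamma_p_nat_cong[of m']] by simp
qed

end

section \<open>The truncated sum\<close>

text \<open>In terms of the theorem, \<open>q = (p + r) / 3\<close> and \<open>s = (p - 2 r) / 3\<close>; this makes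
  \<open>n = q + s\<close>, \<open>r = q - s\<close> and \<open>p = n + q\<close>.\<close>
locale theorem2_setting = prime_number +
  fixes q s :: nat
  assumes p_eq: "p = 2 * q + s" and q_pos: "0 < q" and q_le: "q \<le> Suc s"
    and not_3_dvd: "\<not> 3 dvd int q - int s"
begin

definition n :: nat where "n = q + s"
definition r :: int where "r = int q - int s"
definition a :: complex where "a = of_int r / 3"
text \<open>The scale \<open>2p/3\<close> is forced by \<open>a - t 0 = -n\<close>, the parameter
  that terminates the series.\<close>

definition t :: "nat \<Rightarrow> complex" where "t i = 2 * of_nat p / 3 * zeta5 ^ i"
text \<open>\<open>V k\<close> is the product of the five \<open>(a - t i)_k\<close> and
  \<open>W k\<close> that of the five \<open>(1 + t i)_k\<close>, as \<open>V_eq\<close> and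
  \<open>W_eq\<close> show. Written with fifth powers they are visibly rational and visibly close to
  \<open>(a)_k^5\<close> and \<open>k!^5\<close>.\<close>

definition V :: "nat \<Rightarrow> complex" where "V k = (\<Prod>j\<in>{0..<k}. (a + of_nat j) ^ 5 - t 0 ^ 5)"
definition W :: "nat \<Rightarrow> complex" where "W k = (\<Prod>j\<in>{0..<k}. (1 + of_nat j) ^ 5 + t 0 ^ 5)"

lemma n_pos: "0 < n" and n_less: "n < p"
  using q_pos p_eq by (simp_all add: n_def)

lemma p_not_dvd_3: "\<not> int p dvd 3"
proof
  assume "int p dvd 3"
  then have "p dvd 3" by presburger
  moreover have "prime (3::nat)" by simp
  ultimately have "p = 3" using prime_p primes_dvd_imp_eq by blast
  then have "int q - int s = 3 * (int q - 1)" using p_eq by simp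
  then show False using not_3_dvd by (metis dvd_triv_left)
qed

lemma Ucyc_3 [simp]: "3 \<in> Ucyc"
  using Ucyc_of_int[OF p_not_dvd_3] by simp

lemma Rcyc_a [simp]: "a \<in> Rcyc"
  unfolding a_def by (intro Rcyc_divide) simp_all

lemma t_eq: "t i = of_nat p ^ 1 * (2 * zeta5 ^ i / 3)"
  by (simp add: t_def)

lemma ring_cong_t: "ring_cong 1 (t i) 0"
  unfolding t_eq by (intro ring_cong_0I Rcyc_divide Rcyc_mult Rcyc_power) simp_all

lemma Rcyc_t [simp]: "t i \<in> Rcyc"
  unfolding t_eq by (intro Rcyc_divide Rcyc_mult Rcyc_power) simp_all

lemma a_plus_n: "a + of_nat n = t 0"
proof -
  have "(of_nat p :: complex) = 2 * of_nat q + of_nat s" using p_eq by simp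
  then show ?thesis by (simp add: a_def r_def n_def t_def field_simps)
qed

text \<open>Locates the factor of \<open>(1 - a)_k\<close> that is a multiple of \<open>p\<close>:
  the one of index \<open>q - 1\<close>.\<close>

lemma one_minus_a_plus: "1 - a + of_nat (q - 1) = of_nat p / 3"
  using q_pos by (simp add: a_def r_def p_eq of_nat_diff field_simps)

lemma ring_cong_a: "ring_cong 1 a (- of_nat n)"
proof -
  have "a - (- of_nat n) = t 0 - 0" using a_plus_n by simp
  then show ?thesis using ring_cong_t[of 0] by (simp add: ring_cong_def)
qed

lemma pochhammer_a_neq_0: "pochhammer a m \<noteq> 0"
proof
  assume "pochhammer a m = 0"
  then obtain k where "a = - of_nat k" by (auto simp: pochhammer_eq_0_iff)
  then have "of_int r = (of_int (- 3 * int k) :: complex)" by (simp add: a_def field_simps)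
  then have "r = - 3 * int k" by (simp only: of_int_eq_iff)
  then show False using not_3_dvd by (simp add: r_def)
qed

lemma prod_zeta5:
  "(x - y) * (x - y * zeta5) * (x - y * zeta5 ^ 2) * (x - y * zeta5 ^ 3) * (x - y * zeta5 ^ 4) = x ^ 5 - y ^ 5"
  using zeta5_pow4 zeta5_pow by Groebner_Basis.algebra

lemma t_simps: "t (Suc 0) = t 0 * zeta5" "t 2 = t 0 * zeta5 ^ 2" "t 3 = t 0 * zeta5 ^ 3" "t 4 = t 0 * zeta5 ^ 4"
  by (simp_all add: t_def)

lemma V_eq: "V k = pochhammer (a - t 0) k * pochhammer (a - t 1) k * pochhammer (a - t 2) k
    * pochhammer (a - t 3) k * pochhammer (a - t 4) k"
  unfolding V_def pochhammer_prod prod.distrib[symmetric]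
proof (intro prod.cong refl)
  fix j
  show "(a + of_nat j) ^ 5 - t 0 ^ 5 = (a - t 0 + of_nat j) * (a - t 1 + of_nat j) * (a - t 2 + of_nat j) *
    (a - t 3 + of_nat j) * (a - t 4 + of_nat j)"
    using prod_zeta5[of "a + of_nat j" "t 0"] by (simp add: t_simps algebra_simps)
qed

lemma W_eq: "W k = pochhammer (1 + t 0) k * pochhammer (1 + t 1) k * pochhammer (1 + t 2) k
    * pochhammer (1 + t 3) k * pochhammer (1 + t 4) k"
  unfolding W_def pochhammer_prod prod.distrib[symmetric]
proof (intro prod.cong refl)
  fix j
  show "(1 + of_nat j) ^ 5 + t 0 ^ 5 = (1 + t 0 + of_nat j) * (1 + t 1 + of_nat j) * (1 + t 2 + of_nat j) *
    (1 + t 3 + of_nat j) * (1 + t 4 + of_nat j)"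
    using prod_zeta5[of "1 + of_nat j" "- t 0"] by (simp add: t_simps algebra_simps)
qed

lemma W_factor: "(1 + of_nat j) ^ 5 + t 0 ^ 5 = of_int (243 * (1 + int j) ^ 5 + 32 * int p ^ 5) / 3 ^ 5"
  by (simp add: t_def field_simps)

text \<open>The transformation requires its denominators to be nonzero at every index, not only
  below \<open>p\<close>. Positivity of the integer numerators of \<open>W_factor\<close> gives this
  for all five \<open>(1 + t i)_k\<close> at once.\<close>

lemma W_neq_0: "W k \<noteq> 0"
proof -
  have "243 * (1 + int j) ^ 5 + 32 * int p ^ 5 > 0" for j
    by (intro add_pos_nonneg mult_pos_pos) simp_all
  then have "of_int (243 * (1 + int j) ^ 5 + 32 * int p ^ 5) \<noteq> (0::complex)" for j
    by (metis less_irrefl of_int_eq_0_iff)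
  then show ?thesis unfolding W_def W_factor by (simp del: of_int_add of_int_mult)
qed

lemma W_Ucyc: "k < p \<Longrightarrow> W k \<in> Ucyc"
  unfolding W_def W_factor
proof (intro Ucyc_prod Ucyc_divide Ucyc_of_int Ucyc_power Ucyc_3)
  fix j assume k: "k < p" and j: "j \<in> {0..<k}"
  show "\<not> int p dvd 243 * (1 + int j) ^ 5 + 32 * int p ^ 5"
  proof
    assume "int p dvd 243 * (1 + int j) ^ 5 + 32 * int p ^ 5"
    moreover have "int p dvd 32 * int p ^ 5" by simp
    ultimately have "int p dvd 3 ^ 5 * (1 + int j) ^ 5" by (simp add: dvd_add_left_iff)
    then have "int p dvd 3 \<or> int p dvd 1 + int j"
      using prime_int_p by (metis prime_dvd_mult_iff prime_dvd_power)
    then have "int p dvd int (Suc j)" using p_not_dvd_3 by simp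
    then have "p dvd Suc j" by (simp only: int_dvd_int_iff)
    then show False using k j by (auto dest: dvd_imp_le)
  qed
qed

section \<open>Replacing the truncated sum by its perturbation\<close>

lemma ring_cong_t_pow5: "ring_cong 5 (t 0 ^ 5) 0"
proof -
  have "t 0 ^ 5 = of_nat p ^ 5 * (2 / 3) ^ 5"
    by (simp add: t_def field_simps)
  moreover have "(2 / 3) ^ 5 \<in> Rcyc" by (intro Rcyc_power Rcyc_divide) simp_all
  ultimately show ?thesis using ring_cong_0I by metis
qed

lemma W_cong: "ring_cong 5 (fact k ^ 5) (W k)"
proof -
  have "ring_cong 5 (\<Prod>j\<in>{0..<k}. (1 + of_nat j) ^ 5 + 0) (W k)"
    unfolding W_def
    by (intro ring_cong_prod conjI ring_cong_add ring_cong_refl ring_cong_sym[OF ring_cong_t_pow5] Rcyc_add Rcyc_power)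
      simp_all
  then show ?thesis
    by (simp add: pochhammer_fact pochhammer_prod prod_power_distrib)
qed

text \<open>The sum stops at \<open>n\<close> because \<open>V k\<close> contains
  \<open>(-n)_k\<close>, which vanishes for larger \<open>k\<close>.\<close>

definition L :: complex where
  "L = (\<Sum>k\<le>n. of_int (6 * int k + r) * (pochhammer a k * V k) / (fact k * W k))"

lemma L_cong: "ring_cong 5 (\<Sum>k<p. of_int (6 * int k + r) * pochhammer a k ^ 6 / fact k ^ 6) L"
proof -
  let ?f = "\<lambda>k. of_int (6 * int k + r) * pochhammer a k ^ 6 / fact k ^ 6"
  \<comment> \<open>Beyond \<open>n\<close>, \<open>(a)_k\<close> contains
    \<open>a + n = 2p/3\<close>, so its sixth power is divisible by \<open>p^6\<close>, while
    \<open>k!\<close> is still a unit.\<close>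
  have "ring_cong 5 (\<Sum>k\<in>{Suc n..<p}. ?f k) (\<Sum>k\<in>{Suc n..<p}. 0)"
  proof (rule ring_cong_sum)
    fix k assume k: "k \<in> {Suc n..<p}"
    define w where "w = 2 / 3 * pochhammer a n * pochhammer (a + of_nat (Suc n)) (k - Suc n)"
    have "pochhammer a k = pochhammer a (Suc n) * pochhammer (a + of_nat (Suc n)) (k - Suc n)"
      by (rule pochhammer_product) (use k in simp)
    also have "pochhammer a (Suc n) = of_nat p * (2 / 3) * pochhammer a n"
      unfolding pochhammer_Suc a_plus_n by (simp add: t_def)
    finally have "pochhammer a k = of_nat p * w" by (simp add: w_def)
    then have "?f k = of_nat p ^ 5 * (of_int (6 * int k + r) * of_nat p * w ^ 6 / fact k ^ 6)"
      by (simp add: power_mult_distrib eval_nat_numeral)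
    moreover have "w \<in> Rcyc" unfolding w_def
      by (intro Rcyc_mult Rcyc_divide Rcyc_pochhammer Rcyc_add Rcyc_basic Rcyc_a Ucyc_3)
    then have "of_int (6 * int k + r) * of_nat p * w ^ 6 / fact k ^ 6 \<in> Rcyc"
      using k by (intro Rcyc_mult Rcyc_divide Rcyc_power Ucyc_power Ucyc_fact Rcyc_of_int Rcyc_basic) auto
    ultimately show "ring_cong 5 (?f k) 0" using ring_cong_0I by metis
  qed
  moreover have "ring_cong 5 (\<Sum>k\<le>n. ?f k) L"
    unfolding L_def
  proof (rule ring_cong_sum)
    fix k assume "k \<in> {..n}"
    then have k: "k < p" using n_less by simp
    have RV: "V k \<in> Rcyc" unfolding V_def
      by (intro Rcyc_prod Rcyc_diff Rcyc_power Rcyc_add) simp_all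
    have "ring_cong 5 (\<Prod>j\<in>{0..<k}. (a + of_nat j) ^ 5 - 0) (V k)"
      unfolding V_def
      by (intro ring_cong_prod conjI ring_cong_diff ring_cong_refl ring_cong_sym[OF ring_cong_t_pow5] Rcyc_diff Rcyc_power Rcyc_add)
        simp_all
    then have v: "ring_cong 5 (pochhammer a k ^ 5) (V k)"
      by (simp add: pochhammer_prod prod_power_distrib)
    have "ring_cong 5 (of_int (6 * int k + r) * (pochhammer a k * pochhammer a k ^ 5) / (fact k * fact k ^ 5))
        (of_int (6 * int k + r) * (pochhammer a k * V k) / (fact k * W k))"
      by (intro ring_cong_divide ring_cong_mult ring_cong_refl v W_cong Ucyc_mult Ucyc_fact Ucyc_power W_Ucyc
        Rcyc_mult Rcyc_power Rcyc_pochhammer RV Rcyc_of_int Rcyc_basic Rcyc_a k)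
    then show "ring_cong 5 (?f k) (of_int (6 * int k + r) * (pochhammer a k * V k) / (fact k * W k))"
      by (simp flip: power_Suc)
  qed
  ultimately have "ring_cong 5 ((\<Sum>k\<le>n. ?f k) + (\<Sum>k\<in>{Suc n..<p}. ?f k)) (L + (\<Sum>k\<in>{Suc n..<p}. 0))"
    using ring_cong_add by blast
  moreover have "(\<Sum>k<p. ?f k) = (\<Sum>k\<le>n. ?f k) + (\<Sum>k\<in>{Suc n..<p}. ?f k)"
  proof -
    have "{..<p} = {..n} \<union> {Suc n..<p}" using n_less by auto
    moreover have "{..n} \<inter> {Suc n..<p} = {}" by auto
    ultimately show ?thesis using sum.union_disjoint[of "{..n}" "{Suc n..<p}" ?f] by (simp only: finite_atMost finite_atLeastLessThan)
  qed
  ultimately show ?thesis by (simp only: sum.neutral_const add_0_right)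
qed

section \<open>Transforming the perturbed sum\<close>

definition Z :: "nat \<Rightarrow> complex" where
  "Z i = pochhammer (a - t 4) i * pochhammer (- of_nat n - t 4) i * pochhammer (of_int r - 1) i
     * pochhammer (1 - a + t 3 + t 4) (n - i) * pochhammer (1 - a + t 1 + t 4) (n - i)
     * pochhammer (1 - a + t 2 + t 4) (n - i) / (fact i * fact (n - i))"

text \<open>Apply \<open>well_poised_transformation\<close> with \<open>b\<close>, \<open>c\<close>,
  \<open>d\<close>, \<open>e\<close> equal to \<open>a - t 1\<close>, \<open>a - t 2\<close>,
  \<open>a - t 4\<close>, \<open>a - t 3\<close>. The visible \<open>2 p\<close> is
  \<open>3 * t 0\<close>, coming from the last factor of \<open>(a)_(n+1)\<close>.\<close>

lemma L_formula:
  "L = 2 * of_nat p * fact n * pochhammer a n * pochhammer (1 + t 0) n / W n * (\<Sum>i\<le>n. Z i)"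
proof -
  have nz: "pochhammer (1 + t 0) m \<noteq> 0" "pochhammer (1 + a - (a - t 1)) m \<noteq> 0" "pochhammer (1 + a - (a - t 2)) m \<noteq> 0"
    "pochhammer (1 + a - (a - t 4)) m \<noteq> 0" "pochhammer (1 + a - (a - t 3)) m \<noteq> 0" for m
    using W_neq_0[of m] unfolding W_eq by (auto simp: algebra_simps)
  define Q where "Q = (\<Sum>k\<le>n. pochhammer (a - t 1) k * pochhammer (a - t 2) k * pochhammer (a - t 4) k * pochhammer (a - t 3) k
         / (pochhammer (1 + a - (a - t 1)) k * pochhammer (1 + a - (a - t 2)) k * pochhammer (1 + a - (a - t 4)) k * pochhammer (1 + a - (a - t 3)) k)
         * ((-1) ^ k * pochhammer a k * (a + 2 * of_nat k) / (fact k * (fact (n - k) * pochhammer a (Suc (n + k))))))"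
  have t_sum: "t 1 + t 2 + t 3 + t 4 = - t 0"
  proof -
    have "t 0 + t 1 + t 2 + t 3 + t 4 = t 0 * (1 + zeta5 + zeta5 ^ 2 + zeta5 ^ 3 + zeta5 ^ 4)"
      by (simp add: t_simps algebra_simps)
    also have "\<dots> = 0" by (simp add: zeta5_pow4)
    finally show ?thesis by (simp add: add_eq_0_iff add.assoc)
  qed
  have args: "(a - t 1) + (a - t 2) + (a - t 4) + (a - t 3) - 2 * a - 1 - of_nat n = of_int r - 1"
    "(a - t 4) - a - of_nat n = - of_nat n - t 4"
    "1 + a - (a - t 4) - (a - t 3) = 1 - a + t 3 + t 4"
    "1 + a - (a - t 1) - (a - t 4) = 1 - a + t 1 + t 4"
    "1 + a - (a - t 2) - (a - t 4) = 1 - a + t 2 + t 4"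
  proof -
    have "(a - t 1) + (a - t 2) + (a - t 4) + (a - t 3) - 2 * a - 1 - of_nat n
      = 2 * a - (t 1 + t 2 + t 3 + t 4) - 1 - of_nat n" by simp
    \<comment> \<open>By \<open>t_sum\<close> the other four shifts add up to
      \<open>-t 0 = -(a + n)\<close>, which cancels \<open>n\<close> and leaves
      \<open>3 a - 1\<close>.\<close>
    also have "\<dots> = 3 * a - 1" unfolding t_sum a_plus_n[symmetric] by simp
    finally show "(a - t 1) + (a - t 2) + (a - t 4) + (a - t 3) - 2 * a - 1 - of_nat n = of_int r - 1"
      by (simp add: a_def)
  qed simp_all
  have Wn: "W n = pochhammer (1 + t 0) n * (pochhammer (1 + a - (a - t 1)) n * pochhammer (1 + a - (a - t 2)) n
    * pochhammer (1 + a - (a - t 4)) n * pochhammer (1 + a - (a - t 3)) n)"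
    by (simp add: W_eq)
  have "pochhammer (1 + a - (a - t 1)) n * pochhammer (1 + a - (a - t 2)) n
    * pochhammer (1 + a - (a - t 4)) n * pochhammer (1 + a - (a - t 3)) n * Q = (\<Sum>i\<le>n. Z i)"
    unfolding Q_def well_poised_transformation[OF pochhammer_a_neq_0 nz(2-5)] args Z_def ..
  then have "W n * Q = pochhammer (1 + t 0) n * (\<Sum>i\<le>n. Z i)"
    unfolding Wn by (simp add: mult.assoc)
  then have Q: "Q = pochhammer (1 + t 0) n / W n * (\<Sum>i\<le>n. Z i)"
    using W_neq_0[of n] by (simp add: field_simps)
  \<comment> \<open>Three conversions match the summands: \<open>6 k + r = 3 (a + 2 k)\<close>;
    \<open>(a - t 0)_k = (-n)_k\<close> supplies \<open>n!\<close> and the sign; and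
    \<open>(a)_(n+k+1)\<close> splits at \<open>a + n + 1 = 1 + t 0\<close>.\<close>
  have "L = 3 * fact n * pochhammer a (Suc n) * Q"
    unfolding L_def Q_def sum_distrib_left
  proof (intro sum.cong refl)
    fix k assume "k \<in> {..n}"
    then have k: "k \<le> n" by simp
    have "a - t 0 = - of_nat n" using a_plus_n by (simp add: algebra_simps)
    then have p0: "pochhammer (a - t 0) k = (-1) ^ k * (fact n / fact (n - k))"
      using pochhammer_minus_of_nat[OF k, where 'a=complex] by simp
    have "pochhammer a (Suc (n + k)) = pochhammer a (Suc n) * pochhammer (1 + t 0) k"
      using pochhammer_product'[of a "Suc n" k] a_plus_n by (simp add: add_ac)
    then have pa: "pochhammer a (Suc n) / pochhammer a (Suc (n + k)) = 1 / pochhammer (1 + t 0) k"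
      using pochhammer_a_neq_0[of "Suc n"] by simp
    have r: "of_int (6 * int k + r) = 3 * (a + 2 * of_nat k)"
      by (simp add: a_def)
    show "of_int (6 * int k + r) * (pochhammer a k * V k) / (fact k * W k)
      = 3 * fact n * pochhammer a (Suc n) *
       (pochhammer (a - t 1) k * pochhammer (a - t 2) k * pochhammer (a - t 4) k * pochhammer (a - t 3) k
         / (pochhammer (1 + a - (a - t 1)) k * pochhammer (1 + a - (a - t 2)) k * pochhammer (1 + a - (a - t 4)) k * pochhammer (1 + a - (a - t 3)) k)
         * ((-1) ^ k * pochhammer a k * (a + 2 * of_nat k) / (fact k * (fact (n - k) * pochhammer a (Suc (n + k))))))"
      (is "?l = ?r")
    proof -
      have "?r = 3 * (a + 2 * of_nat k) * pochhammer a k / fact k * ((-1) ^ k * (fact n / fact (n - k)))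
         * (pochhammer a (Suc n) / pochhammer a (Suc (n + k)))
         * (pochhammer (a - t 1) k * pochhammer (a - t 2) k * pochhammer (a - t 4) k * pochhammer (a - t 3) k
         / (pochhammer (1 + a - (a - t 1)) k * pochhammer (1 + a - (a - t 2)) k * pochhammer (1 + a - (a - t 4)) k * pochhammer (1 + a - (a - t 3)) k))"
        by (simp only: times_divide_times_eq times_divide_eq_right times_divide_eq_left divide_divide_eq_left mult_ac)
      also have "\<dots> = ?l"
        unfolding pa p0[symmetric] r V_eq W_eq by (simp add: mult_ac)
      finally show ?thesis by simp
    qed
  qed
  also have "pochhammer a (Suc n) = t 0 * pochhammer a n"
    unfolding pochhammer_Suc a_plus_n by simp
  finally show ?thesis unfolding Q by (simp add: t_def)
qed

text \<open>Equal to \<open>1 - r\<close>; the subtraction is exact because \<open>q\<close> is at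
  most \<open>s + 1\<close>.\<close>

definition N :: nat where "N = Suc s - q"

lemma N_le: "N \<le> s" and N_le_n: "N \<le> n"
  using q_pos by (simp_all add: N_def n_def)

lemma r_minus_1: "of_int r - 1 = (- of_nat N :: complex)"
  using q_le by (simp add: r_def N_def of_nat_diff)

lemma Z_vanish: "N < i \<Longrightarrow> Z i = 0"
  unfolding Z_def r_minus_1 by (simp add: pochhammer_of_nat_eq_0_lemma)

section \<open>The factor p^3 and the residue of its cofactor\<close>

lemma zeta5_product: "(1 + 2 * zeta5 ^ 3 + 2 * zeta5 ^ 4) * (1 + 2 * zeta5 ^ 1 + 2 * zeta5 ^ 4)
    * (1 + 2 * zeta5 ^ 2 + 2 * zeta5 ^ 4) = - 5"
  using zeta5_pow4 zeta5_pow by Groebner_Basis.algebra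

text \<open>What remains of \<open>(1 - a + t j + t 4)_k\<close> once the multiple of
  \<open>p\<close> at index \<open>q - 1\<close> is taken out; \<open>m\<close> stands for
  \<open>k - q\<close>, the number of factors after it.\<close>

definition v :: "nat \<Rightarrow> nat \<Rightarrow> complex" where
  "v j m = pochhammer (1 - a + t j + t 4) (q - 1) * pochhammer (1 + of_nat p / 3 + t j + t 4) m"

lemma pochhammer_split_p:
  assumes "q \<le> k"
  shows "pochhammer (1 - a + t j + t 4) k = of_nat p / 3 * (1 + 2 * zeta5 ^ j + 2 * zeta5 ^ 4) * v j (k - q)"
proof -
  define x where "x = 1 - a + t j + t 4"
  have "x + of_nat (q - 1) = (1 - a + of_nat (q - 1)) + t j + t 4" by (simp add: x_def)
  then have xq: "x + of_nat (q - 1) = of_nat p / 3 + t j + t 4" unfolding one_minus_a_plus .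
  have x: "x + of_nat (q - 1) = of_nat p / 3 * (1 + 2 * zeta5 ^ j + 2 * zeta5 ^ 4)"
    unfolding xq by (simp add: t_def field_simps)
  have x': "x + of_nat (q - 1) + 1 = 1 + of_nat p / 3 + t j + t 4"
    unfolding xq by simp
  have "pochhammer x k = pochhammer x (q - 1) * pochhammer (x + of_nat (q - 1)) (k - (q - 1))"
    by (rule pochhammer_product) (use assms in simp)
  also have "k - (q - 1) = Suc (k - q)" using assms q_pos by simp
  also have "pochhammer (x + of_nat (q - 1)) (Suc (k - q))
     = of_nat p / 3 * (1 + 2 * zeta5 ^ j + 2 * zeta5 ^ 4) * pochhammer (1 + of_nat p / 3 + t j + t 4) (k - q)"
    unfolding pochhammer_rec x' unfolding x ..
  finally show ?thesis by (simp add: v_def x_def mult_ac)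
qed

lemma Rcyc_p_div_3 [simp]: "of_nat p / 3 \<in> Rcyc"
  by (rule Rcyc_divide) simp_all

lemma ring_cong_p_div_3: "ring_cong 1 (of_nat p / 3) 0"
  using ring_cong_0I[of "1 / 3" 1] Rcyc_divide[of 1 3] by simp

lemma Rcyc_v [simp]: "v j m \<in> Rcyc"
  unfolding v_def
  by (intro Rcyc_mult Rcyc_pochhammer Rcyc_add Rcyc_diff Rcyc_t Rcyc_a Rcyc_basic Rcyc_p_div_3)

lemma fact_Ucyc_le: "k \<le> n \<Longrightarrow> fact k \<in> Ucyc"
  using n_less by (intro Ucyc_fact) simp

text \<open>Modulo \<open>p\<close> the shifts vanish and \<open>a\<close> becomes
  \<open>-n\<close>. The factors before the gap give \<open>(n + 1)_(q-1) = (p - 1)! / n!\<close>,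
  to which Wilson applies, and those after it give \<open>m!\<close>.\<close>

lemma ring_cong_v: "ring_cong 1 (v j m) (- (fact m / fact n))"
proof -
  have "ring_cong 1 (1 - a + t j + t 4) (1 - (- of_nat n) + 0 + 0)"
    by (intro ring_cong_add ring_cong_diff ring_cong_refl ring_cong_a ring_cong_t)
  then have 1: "ring_cong 1 (pochhammer (1 - a + t j + t 4) (q - 1)) (pochhammer (1 + of_nat n) (q - 1))"
    by (intro ring_cong_pochhammer Rcyc_add Rcyc_diff Rcyc_t Rcyc_a Rcyc_basic) simp
  have "ring_cong 1 (1 + of_nat p / 3 + t j + t 4) (1 + 0 + 0 + 0)"
    by (intro ring_cong_add ring_cong_refl ring_cong_p_div_3 ring_cong_t)
  then have 2: "ring_cong 1 (pochhammer (1 + of_nat p / 3 + t j + t 4) m) (fact m)"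
    unfolding pochhammer_fact
    by (intro ring_cong_pochhammer Rcyc_add Rcyc_t Rcyc_basic Rcyc_p_div_3) simp
  have "n + (q - 1) = p - 1" using q_pos p_eq by (simp add: n_def)
  then have "fact (p - 1) = fact n * pochhammer (1 + of_nat n :: complex) (q - 1)"
    using pochhammer_product'[of "1::complex" n "q - 1"] by (simp add: pochhammer_fact)
  then have 3: "pochhammer (1 + of_nat n) (q - 1) = (fact (p - 1) / fact n :: complex)"
    by simp
  have "ring_cong 1 (of_int (fact (p - 1))) (of_int (- 1))"
    using wilson_theorem[OF prime_p] by (rule ring_cong_of_int)
  then have "ring_cong 1 (fact (p - 1) / fact n) (- 1 / fact n)"
    by (intro ring_cong_divide fact_Ucyc_le Rcyc_uminus Rcyc_basic) simp_all
  from ring_cong_trans[OF 1[unfolded 3] this]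
  have "ring_cong 1 (v j m) (- 1 / fact n * fact m)"
    unfolding v_def
    by (intro ring_cong_mult 2 Rcyc_pochhammer Rcyc_divide Rcyc_uminus fact_Ucyc_le Rcyc_add Rcyc_t Rcyc_basic Rcyc_p_div_3)
       simp_all
  then show ?thesis by simp
qed

definition z :: "nat \<Rightarrow> complex" where
  "z i = pochhammer (a - t 4) i * pochhammer (- of_nat n - t 4) i * pochhammer (of_int r - 1) i
     * (v 3 (s - i) * v 1 (s - i) * v 2 (s - i)) / (fact i * fact (n - i))"

lemma Z_eq:
  assumes "i \<le> N"
  shows "Z i = of_nat p ^ 3 * (- 5 / 27) * z i"
proof -
  \<comment> \<open>Since \<open>n - q = s\<close> and \<open>N\<close> is at most \<open>s\<close>,
    each of the three symbols in \<open>Z i\<close> is long enough to reach its multiple of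
    \<open>p\<close>.\<close>
  have i: "q \<le> n - i" "n - i - q = s - i"
    using N_le assms by (simp_all add: n_def)
  define k1 k2 k3 where "k1 = 1 + 2 * zeta5 ^ 3 + 2 * zeta5 ^ 4"
    and "k2 = 1 + 2 * zeta5 ^ 1 + 2 * zeta5 ^ 4" and "k3 = 1 + 2 * zeta5 ^ 2 + 2 * zeta5 ^ 4"
  have k: "k1 * k2 * k3 = - 5" using zeta5_product by (simp add: k1_def k2_def k3_def)
  have "Z i = (of_nat p / 3) ^ 3 * (k1 * k2 * k3) * z i"
    unfolding Z_def pochhammer_split_p[OF i(1)] i(2) z_def k1_def[symmetric] k2_def[symmetric] k3_def[symmetric]
    by (simp add: power3_eq_cube)
  then show ?thesis unfolding k by (simp add: power_divide)
qed

lemma Rcyc_r_minus_1 [simp]: "of_int r - 1 \<in> Rcyc"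
  by (intro Rcyc_diff Rcyc_of_int Rcyc_basic)

lemma z_cong:
  assumes "i \<le> N"
  shows "ring_cong 1 (z i) (- (pochhammer (of_int r - 1) i * fact (s - i) ^ 3 / (fact i * fact (n - i) ^ 3)) / fact n)"
proof -
  have i: "i \<le> n" using assms N_le_n by simp
  define x where "x = fact (s - i) / (fact n :: complex)"
  have x: "x \<in> Rcyc" unfolding x_def
    by (intro Rcyc_divide fact_Ucyc_le Rcyc_basic) simp
  have "ring_cong 1 (a - t 4) (- of_nat n - 0)" "ring_cong 1 (- of_nat n - t 4) (- of_nat n - 0)"
    by (intro ring_cong_diff ring_cong_refl ring_cong_a ring_cong_t)+
  then have "ring_cong 1 (pochhammer (a - t 4) i) (pochhammer (- of_nat n) i)"
     "ring_cong 1 (pochhammer (- of_nat n - t 4) i) (pochhammer (- of_nat n) i)"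
    by (intro ring_cong_pochhammer Rcyc_diff Rcyc_uminus Rcyc_a Rcyc_t Rcyc_basic; simp)+
  then have "ring_cong 1 (z i) (pochhammer (- of_nat n) i * pochhammer (- of_nat n) i * pochhammer (of_int r - 1) i
     * ((- x) * (- x) * (- x)) / (fact i * fact (n - i)))"
    unfolding z_def x_def using i
    by (intro ring_cong_divide ring_cong_mult ring_cong_refl ring_cong_v Rcyc_mult Rcyc_pochhammer Rcyc_uminus
      Rcyc_basic Rcyc_v Rcyc_r_minus_1 Ucyc_mult fact_Ucyc_le x[unfolded x_def] Rcyc_diff Rcyc_t) simp_all
  also have "pochhammer (- of_nat n) i * pochhammer (- of_nat n) i * pochhammer (of_int r - 1) i
     * ((- x) * (- x) * (- x)) / (fact i * fact (n - i))
    = - (pochhammer (of_int r - 1) i * fact (s - i) ^ 3 / (fact i * fact (n - i) ^ 3)) / fact n"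
  proof -
    have "((-1) ^ i * (-1) ^ i :: complex) = 1" by (simp flip: power_mult_distrib)
    then have "pochhammer (- of_nat n) i * pochhammer (- of_nat n) i = (fact n / fact (n - i) * (fact n / fact (n - i)) :: complex)"
      unfolding pochhammer_minus_of_nat[OF i] by (simp add: mult_ac)
    then show ?thesis by (simp add: x_def field_simps power3_eq_cube)
  qed
  finally show ?thesis .
qed

text \<open>The meeting point of the two sides: modulo \<open>p\<close>, both \<open>Y\<close> and
  the sum \<open>S\<close> of the theorem are explicit multiples of \<open>Sig\<close>.\<close>

definition Sig :: complex where
  "Sig = (\<Sum>i\<le>N. pochhammer (of_int r - 1) i * fact (s - i) ^ 3 / (fact i * fact (n - i) ^ 3))"

lemma Rcyc_Sig [simp]: "Sig \<in> Rcyc"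
  unfolding Sig_def using N_le_n
  by (intro Rcyc_sum Rcyc_divide Rcyc_mult Rcyc_pochhammer Rcyc_r_minus_1 Rcyc_power Rcyc_basic
    Ucyc_mult Ucyc_power fact_Ucyc_le) simp_all

definition Y :: complex where
  "Y = 2 * fact n * pochhammer a n * pochhammer (1 + t 0) n / W n * ((- 5 / 27) * (\<Sum>i\<le>N. z i))"

lemma L_eq_Y: "L = of_nat p ^ 4 * Y"
proof -
  have "(\<Sum>i\<le>n. Z i) = (\<Sum>i\<le>N. Z i)"
    by (rule sum.mono_neutral_right) (use N_le_n Z_vanish in auto)
  also have "\<dots> = of_nat p ^ 3 * ((- 5 / 27) * (\<Sum>i\<le>N. z i))"
    unfolding sum_distrib_left by (intro sum.cong refl) (simp add: Z_eq)
  finally show ?thesis unfolding L_formula Y_def by (simp add: eval_nat_numeral)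
qed

lemma Ucyc_27: "27 \<in> Ucyc"
  using Ucyc_power[OF Ucyc_3, of 3] by simp

lemma Ucyc_81: "81 \<in> Ucyc"
  using Ucyc_power[OF Ucyc_3, of 4] by simp

lemma Y_cong: "ring_cong 1 Y (10 / 27 * (-1) ^ n / fact n ^ 3 * Sig)"
proof -
  have zs: "ring_cong 1 (\<Sum>i\<le>N. z i) (- Sig / fact n)"
  proof -
    have "ring_cong 1 (\<Sum>i\<le>N. z i) (\<Sum>i\<le>N. - (pochhammer (of_int r - 1) i * fact (s - i) ^ 3 / (fact i * fact (n - i) ^ 3)) / fact n)"
      by (rule ring_cong_sum) (use z_cong in simp)
    then show ?thesis by (simp add: Sig_def sum_divide_distrib sum_negf)
  qed
  have Rz: "(\<Sum>i\<le>N. z i) \<in> Rcyc"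
    unfolding z_def using N_le_n
    by (intro Rcyc_sum Rcyc_divide Rcyc_mult Rcyc_pochhammer Rcyc_r_minus_1 Rcyc_diff Rcyc_uminus Rcyc_t Rcyc_a Rcyc_basic
      Rcyc_v Ucyc_mult fact_Ucyc_le) simp_all
  have W1: "ring_cong 1 (W n) (fact n ^ 5)"
    by (rule ring_cong_sym, rule ring_cong_mono[OF W_cong]) simp
  have t1: "ring_cong 1 (pochhammer (1 + t 0) n) (fact n)"
  proof -
    have "ring_cong 1 (1 + t 0) (1 + 0)"
      by (intro ring_cong_add ring_cong_refl ring_cong_t)
    then show ?thesis unfolding pochhammer_fact
      by (intro ring_cong_pochhammer Rcyc_add Rcyc_t Rcyc_basic) simp
  qed
  have an: "ring_cong 1 (pochhammer a n) (pochhammer (- of_nat n) n)"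
    by (intro ring_cong_pochhammer ring_cong_a Rcyc_a Rcyc_uminus Rcyc_basic)
  have "ring_cong 1 Y (2 * fact n * pochhammer (- of_nat n) n * fact n / fact n ^ 5 * ((- 5 / 27) * (- Sig / fact n)))"
    unfolding Y_def
    by (intro ring_cong_mult[OF ring_cong_divide[OF ring_cong_mult[OF ring_cong_mult[OF ring_cong_refl an] t1] W1]
         ring_cong_mult[OF ring_cong_refl zs]] Rcyc_mult Rcyc_pochhammer Rcyc_a Rcyc_add Rcyc_t Rcyc_divide Rcyc_uminus
       Rcyc_basic Ucyc_27 Rz W_Ucyc n_less Ucyc_power fact_Ucyc_le order_refl)
  also have "2 * fact n * pochhammer (- of_nat n) n * fact n / fact n ^ 5 * ((- 5 / 27) * (- Sig / fact n))
     = 10 / 27 * (-1) ^ n / fact n ^ 3 * Sig"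
    unfolding pochhammer_minus_of_nat[OF order_refl] by (simp add: field_simps eval_nat_numeral)
  finally show ?thesis .
qed

section \<open>Gamma values modulo p as factorials\<close>

lemma gamma_p_nat_cong_fact:
  assumes "m > 0" "[3 * int m = 3 + k] (mod int p)" "[3 * int u = k] (mod int p)" "u < p"
  shows "[gamma_p_nat p m = (-1) ^ Suc u * fact u] (mod int p)"
proof -
  obtain m' where m: "m = Suc m'" using assms(1) by (cases m) auto
  have "[3 + 3 * int m' = 3 + 3 * int u] (mod int p)"
    using assms(2) cong_add[OF cong_refl[of 3] assms(3)] unfolding m
    by (simp add: cong_def algebra_simps)
  then have "[3 * int m' = 3 * int u] (mod int p)" by (simp only: cong_add_lcancel)
  moreover have "coprime 3 (int p)"
    using p_not_dvd_3 prime_int_p by (metis coprime_commute prime_imp_coprime)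
  ultimately have "[int m' = int u] (mod int p)" by (simp add: cong_mult_lcancel)
  then have "[m' = u] (mod p)" by (simp only: cong_int_iff)
  then have "m' mod p = u" using assms(4) by (simp add: cong_def)
  then show ?thesis unfolding m using gamma_p_nat_cong[of m'] by simp
qed

text \<open>The residue of \<open>r/3\<close> is \<open>q\<close>, because
  \<open>3 q - r = p\<close>. The complement formula for factorials then replaces \<open>q!\<close>
  by the reciprocal of \<open>(n - 1)!\<close>, as \<open>q + (n - 1) = p - 1\<close>.\<close>

lemma gamma1:
  assumes "m > 0" "[3 * int m = 3 + r] (mod int p)"
  shows "ring_cong 1 (of_int (gamma_p_nat p m)) (1 / fact (n - 1))"
proof -
  have "3 * int q - r = int p" using p_eq by (simp add: r_def)
  then have "[3 * int q = r] (mod int p)" by (simp add: cong_iff_dvd_diff)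
  then have "[gamma_p_nat p m = (-1) ^ Suc q * fact q] (mod int p)"
    using assms p_eq n_pos q_pos n_def n_less by (intro gamma_p_nat_cong_fact) auto
  then have "[gamma_p_nat p m * fact (n - 1) = (-1) ^ Suc q * fact q * fact (n - 1)] (mod int p)"
    by (rule cong_scalar_right)
  also have "(-1) ^ Suc q * fact q * fact (n - 1) = (-1 :: int) ^ Suc q * (fact (n - 1) * fact q)" by simp
  also have "[(-1 :: int) ^ Suc q * (fact (n - 1) * fact q) = (-1) ^ Suc q * (-1) ^ n] (mod int p)"
  proof (rule cong_scalar_left)
    have "p - 1 - (n - 1) = q" "n - 1 + 1 = n" using n_pos p_eq by (simp_all add: n_def)
    then show "[fact (n - 1) * fact q = (-1) ^ n] (mod int p)"
      using fact_mult_fact_cong[of "n - 1"] n_less by simp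
  qed
  also have "(-1 :: int) ^ Suc q * (-1) ^ n = - ((-1) ^ p)"
    by (simp add: n_def p_eq power_add[symmetric] mult_2 add_ac)
  also have "[- ((-1) ^ p) = - (- 1)] (mod int p)"
    using neg_one_power_p by (simp only: cong_minus_minus_iff)
  finally have "ring_cong 1 (of_int (gamma_p_nat p m * fact (n - 1))) (of_int 1)"
    by (intro ring_cong_of_int) simp
  then have "ring_cong 1 (of_int (gamma_p_nat p m) * fact (n - 1) / fact (n - 1)) (1 / fact (n - 1))"
    by (intro ring_cong_divide fact_Ucyc_le ring_cong_refl Rcyc_basic) simp_all
  then show ?thesis by simp
qed

text \<open>The residue of \<open>2r/3\<close> is \<open>2 q\<close>, whose complement in
  \<open>p - 1\<close> is \<open>s - 1\<close>. For \<open>s = 0\<close> the number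
  \<open>2 q = p\<close> would not be a reduced residue.\<close>

lemma gamma2:
  assumes "m > 0" "[3 * int m = 3 + 2 * r] (mod int p)" "s > 0"
  shows "ring_cong 1 (of_int (gamma_p_nat p m)) (1 / fact (s - 1))"
proof -
  have "3 * int (2 * q) - 2 * r = 2 * int p" using p_eq by (simp add: r_def)
  then have "[3 * int (2 * q) = 2 * r] (mod int p)" by (simp add: cong_iff_dvd_diff)
  then have "[gamma_p_nat p m = (-1) ^ Suc (2 * q) * fact (2 * q)] (mod int p)"
    using assms p_eq by (intro gamma_p_nat_cong_fact) auto
  then have "[gamma_p_nat p m * fact (s - 1) = (-1) ^ Suc (2 * q) * fact (2 * q) * fact (s - 1)] (mod int p)"
    by (rule cong_scalar_right)
  also have "(-1) ^ Suc (2 * q) * fact (2 * q) * fact (s - 1) = (-1 :: int) ^ Suc (2 * q) * (fact (s - 1) * fact (2 * q))" by simp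
  also have "[(-1 :: int) ^ Suc (2 * q) * (fact (s - 1) * fact (2 * q)) = (-1) ^ Suc (2 * q) * (-1) ^ s] (mod int p)"
  proof (rule cong_scalar_left)
    have "p - 1 - (s - 1) = 2 * q" "s - 1 + 1 = s" "s - 1 < p" using assms(3) p_eq q_pos by simp_all
    then show "[fact (s - 1) * fact (2 * q) = (-1) ^ s] (mod int p)"
      using fact_mult_fact_cong[of "s - 1"] by simp
  qed
  also have "(-1 :: int) ^ Suc (2 * q) * (-1) ^ s = - ((-1) ^ p)"
    by (simp add: p_eq power_add)
  also have "[- ((-1) ^ p) = - (- 1)] (mod int p)"
    using neg_one_power_p by (simp only: cong_minus_minus_iff)
  finally have "ring_cong 1 (of_int (gamma_p_nat p m * fact (s - 1))) (of_int 1)"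
    by (intro ring_cong_of_int) simp
  then have "ring_cong 1 (of_int (gamma_p_nat p m) * fact (s - 1) / fact (s - 1)) (1 / fact (s - 1))"
    using n_def by (intro ring_cong_divide fact_Ucyc_le ring_cong_refl Rcyc_basic) simp_all
  then show ?thesis by simp
qed

text \<open>The residue of \<open>-r/3\<close> is \<open>n\<close> itself, because
  \<open>3 n + r = 2 p\<close>.\<close>

lemma gamma3:
  assumes "m > 0" "[3 * int m = 3 - r] (mod int p)"
  shows "ring_cong 1 (of_int (gamma_p_nat p m)) ((-1) ^ Suc n * fact n)"
proof -
  have "3 * int n - (- r) = 2 * int p" using p_eq by (simp add: r_def n_def)
  then have "[3 * int n = - r] (mod int p)" unfolding cong_iff_dvd_diff by simp
  then have "[gamma_p_nat p m = (-1) ^ Suc n * fact n] (mod int p)"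
    using assms n_less by (intro gamma_p_nat_cong_fact) auto
  from ring_cong_of_int[OF this] show ?thesis by simp
qed

section \<open>Matching the two cofactors modulo p\<close>

definition S :: complex where
  "S = (\<Sum>k\<le>N. pochhammer (of_int r - 1) k * pochhammer a k ^ 3 / (pochhammer 1 k * pochhammer (2 * a) k ^ 3))"

text \<open>The first multiple of \<open>p\<close> among the factors would be
  \<open>2 a + s = p/3\<close>, of index \<open>s\<close>, just out of reach for \<open>k\<close> at
  most \<open>s\<close>.\<close>

lemma two_a_Ucyc:
  assumes "k \<le> s"
  shows "pochhammer (2 * a) k \<in> Ucyc"
proof -
  have eq: "2 * a + of_nat j = of_int (int p - 3 * int (s - j)) / 3" if "j < k" for j
  proof -
    have "(of_nat p :: complex) = 2 * of_nat q + of_nat s" using p_eq by simp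
    then show ?thesis using that assms by (simp add: a_def r_def of_nat_diff field_simps)
  qed
  have "pochhammer (2 * a) k = (\<Prod>j\<in>{0..<k}. of_int (int p - 3 * int (s - j)) / 3)"
    unfolding pochhammer_prod by (intro prod.cong refl, rule eq, simp)
  also have "\<dots> \<in> Ucyc"
  proof (intro Ucyc_prod Ucyc_divide Ucyc_of_int Ucyc_3 notI)
    fix j assume j: "j \<in> {0..<k}" and d: "int p dvd int p - 3 * int (s - j)"
    have "int p dvd 3 * int (s - j)" using dvd_diff[OF dvd_refl d] by simp
    then have "int p dvd int (s - j)" using prime_int_p p_not_dvd_3 by (metis prime_dvd_mult_iff)
    then have "p dvd s - j" by (simp only: int_dvd_int_iff)
    then show False using j assms p_eq q_pos by (auto dest!: dvd_imp_le)
  qed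
  finally show ?thesis .
qed

text \<open>Modulo \<open>p\<close>, \<open>a\<close> is \<open>-n\<close> and \<open>2 a\<close> is
  \<open>-s\<close>; rewriting both symbols as quotients of factorials cancels the signs and gives
  the summands of \<open>Sig\<close>.\<close>

lemma S_cong: "ring_cong 1 S ((fact n / fact s) ^ 3 * Sig)"
proof -
  have 2: "ring_cong 1 (2 * a) (- of_nat s)"
  proof -
    have "(of_nat p :: complex) = 2 * of_nat q + of_nat s" using p_eq by simp
    then have "2 * a - (- of_nat s) = of_nat p / 3 - 0"
      by (simp add: a_def r_def field_simps)
    then show ?thesis using ring_cong_p_div_3 unfolding ring_cong_def by (simp only:)
  qed
  have "ring_cong 1 S (\<Sum>k\<le>N. pochhammer (of_int r - 1) k * pochhammer (- of_nat n) k ^ 3 / (fact k * pochhammer (- of_nat s) k ^ 3))"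
    unfolding S_def pochhammer_fact[symmetric]
  proof (intro ring_cong_sum)
    fix k assume "k \<in> {..N}"
    then have k: "k \<le> s" "k \<le> n" "s < p" using N_le N_le_n p_eq q_pos by simp_all
    have u: "pochhammer (- of_nat s) k \<in> Ucyc"
      unfolding pochhammer_minus_of_nat[OF k(1)] using k
      by (intro Ucyc_mult Ucyc_divide Ucyc_fact Ucyc_power Ucyc_minus_1) auto
    show "ring_cong 1 (pochhammer (of_int r - 1) k * pochhammer a k ^ 3 / (fact k * pochhammer (2 * a) k ^ 3))
       (pochhammer (of_int r - 1) k * pochhammer (- of_nat n) k ^ 3 / (fact k * pochhammer (- of_nat s) k ^ 3))"
      by (intro ring_cong_divide ring_cong_mult ring_cong_refl ring_cong_power ring_cong_pochhammer ring_cong_a 2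
        Rcyc_mult Rcyc_pochhammer Rcyc_power Rcyc_a Rcyc_uminus Rcyc_basic Rcyc_r_minus_1 Ucyc_mult Ucyc_power
        two_a_Ucyc u fact_Ucyc_le k)
  qed
  also have "(\<Sum>k\<le>N. pochhammer (of_int r - 1) k * pochhammer (- of_nat n) k ^ 3 / (fact k * pochhammer (- of_nat s) k ^ 3))
     = (fact n / fact s) ^ 3 * Sig"
    unfolding Sig_def sum_distrib_left
  proof (intro sum.cong refl)
    fix k assume "k \<in> {..N}"
    then have k: "k \<le> s" "k \<le> n" using N_le N_le_n by simp_all
    have "pochhammer (of_int r - 1) k * ((-1) ^ k * (fact n / fact (n - k))) ^ 3 / (fact k * ((-1) ^ k * (fact s / fact (s - k))) ^ 3)
      = (fact n / fact s) ^ 3 * (pochhammer (of_int r - 1) k * fact (s - k) ^ 3 / (fact k * fact (n - k) ^ 3) :: complex)"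
      by (simp add: power_mult_distrib power_divide mult_ac)
    then show "pochhammer (of_int r - 1) k * pochhammer (- of_nat n) k ^ 3 / (fact k * pochhammer (- of_nat s) k ^ 3)
      = (fact n / fact s) ^ 3 * (pochhammer (of_int r - 1) k * fact (s - k) ^ 3 / (fact k * fact (n - k) ^ 3) :: complex)"
      unfolding pochhammer_minus_of_nat[OF k(1)] pochhammer_minus_of_nat[OF k(2)] .
  qed
  finally show ?thesis .
qed

lemma Rcyc_S: "S \<in> Rcyc"
  unfolding S_def pochhammer_fact[symmetric] using N_le N_le_n
  by (intro Rcyc_sum Rcyc_divide Rcyc_mult Rcyc_pochhammer Rcyc_power Rcyc_a Rcyc_r_minus_1 Ucyc_mult Ucyc_power
     two_a_Ucyc fact_Ucyc_le) simp_all

text \<open>For positive \<open>s\<close> the Gamma quotient and the factor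
  \<open>(n! / s!)^3\<close> of \<open>S_cong\<close> collapse to \<open>n^2 / (s^3 n!^3)\<close>.
  With \<open>r\<close> congruent to \<open>-3 n\<close>, the constant \<open>80/81\<close> then
  becomes \<open>10/27\<close> times \<open>(2 n / s)^3\<close>.\<close>

lemma Y_cong_rhs:
  assumes m: "m1 > 0" "m2 > 0" "m3 > 0"
    and "[3 * int m1 = 3 + r] (mod int p)" "[3 * int m2 = 3 + 2 * r] (mod int p)" "[3 * int m3 = 3 - r] (mod int p)"
  defines "G \<equiv> \<lambda>m. of_int (gamma_p_nat p m) :: complex"
  shows "ring_cong 1 Y ((-1) powi (r + 1) * 80 * of_int r / 81 * (G m1 ^ 2 / (G m2 ^ 3 * G m3 ^ 4)) * S)"
proof -
  have GU: "G m2 \<in> Ucyc" "G m3 \<in> Ucyc"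
    unfolding G_def by (intro Ucyc_of_int gamma_p_nat_not_dvd m)+
  have GR: "G m1 \<in> Rcyc" by (simp add: G_def)
  \<comment> \<open>\<open>r + 1 = q - s + 1\<close> and \<open>n + 1 = q + s + 1\<close> have the
    same parity; \<open>powi\<close> is used because \<open>r + 1\<close> may be negative.\<close>
  have sgn: "(-1) powi (r + 1) = (-1 :: complex) ^ Suc n"
  proof -
    have "even (r + 1) \<longleftrightarrow> even (Suc n)" by (simp add: r_def n_def)
    then show ?thesis by (cases "even (Suc n)") (auto simp: power_int_minus_left)
  qed
  define H where "H = G m1 ^ 2 / (G m2 ^ 3 * G m3 ^ 4)"
  have HR: "H \<in> Rcyc" unfolding H_def
    by (intro Rcyc_divide Rcyc_power GR Ucyc_mult Ucyc_power GU)
  have sg: "(-1) ^ k \<in> Rcyc" for k by (intro Rcyc_power Rcyc_uminus Rcyc_basic)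
  have "ring_cong 1 (10 / 27 * (-1) ^ n / fact n ^ 3 * Sig) ((-1) ^ Suc n * 80 * of_int r / 81 * H * S)"
  proof (cases "s = 0")
    case True
    \<comment> \<open>then \<open>p = 2\<close> and \<open>r = 1\<close>, and both sides are even\<close>
    then have "p = 2" using q_le q_pos p_eq by simp
    then have p2: "of_nat p ^ 1 = (2 :: complex)" by simp
    have "ring_cong 1 (of_nat p ^ 1 * (5 / 27 * (-1) ^ n / fact n ^ 3 * Sig)) 0"
      by (intro ring_cong_0I Rcyc_mult Rcyc_divide Rcyc_Sig sg Ucyc_27 Ucyc_power fact_Ucyc_le Rcyc_basic order_refl)
    moreover have "ring_cong 1 (of_nat p ^ 1 * ((-1) ^ Suc n * 40 * of_int r / 81 * H * S)) 0"
      by (intro ring_cong_0I Rcyc_mult Rcyc_divide Rcyc_S HR sg Ucyc_81 Rcyc_of_int Rcyc_basic)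
    ultimately have "ring_cong 1 (of_nat p ^ 1 * (5 / 27 * (-1) ^ n / fact n ^ 3 * Sig))
        (of_nat p ^ 1 * ((-1) ^ Suc n * 40 * of_int r / 81 * H * S))"
      using ring_cong_trans ring_cong_sym by blast
    then show ?thesis unfolding p2 by (simp add: mult_ac)
  next
    case False
    then have s: "0 < s" "s < p" "s - 1 < p" using p_eq q_pos by simp_all
    have g1: "ring_cong 1 (G m1) (1 / fact (n - 1))"
      unfolding G_def using m(1) assms(4) by (rule gamma1)
    have g2: "ring_cong 1 (G m2) (1 / fact (s - 1))"
      unfolding G_def using m(2) assms(5) s(1) by (rule gamma2)
    have g3: "ring_cong 1 (G m3) ((-1) ^ Suc n * fact n)"
      unfolding G_def using m(3) assms(6) by (rule gamma3)
    have fs: "1 / fact (s - 1) \<in> Ucyc" by (intro Ucyc_divide Ucyc_1 Ucyc_fact s)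
    have fn: "1 / fact (n - 1) \<in> Ucyc" using n_less by (intro Ucyc_divide Ucyc_1 Ucyc_fact) simp
    have ffn: "(-1) ^ Suc n * fact n \<in> Ucyc"
      using n_less by (intro Ucyc_mult Ucyc_power Ucyc_fact Ucyc_minus_1)
    have H: "ring_cong 1 H ((1 / fact (n - 1)) ^ 2 / ((1 / fact (s - 1)) ^ 3 * ((-1) ^ Suc n * fact n) ^ 4))"
      unfolding H_def
      by (intro ring_cong_divide ring_cong_mult ring_cong_power g1 g2 g3 Rcyc_power GR Ucyc_Rcyc[OF fn] Ucyc_Rcyc[OF fs]
        Ucyc_Rcyc[OF ffn] Ucyc_Rcyc[OF GU(1)] Ucyc_Rcyc[OF GU(2)] Ucyc_mult Ucyc_power fs Ucyc_minus_1 fact_Ucyc_le order_refl GU)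
    have rr: "ring_cong 1 (of_int r) (- 3 * of_nat n)"
    proof -
      have "ring_cong 1 (3 * a) (3 * (- of_nat n))"
        by (intro ring_cong_mult ring_cong_refl ring_cong_a Rcyc_a Rcyc_basic)
      then show ?thesis by (simp add: a_def)
    qed
    \<comment> \<open>Since \<open>2 n = s + p\<close>, the leftover cube is 1 modulo
      \<open>p\<close>.\<close>
    have nn: "ring_cong 1 ((2 * of_nat n) ^ 3 / of_nat s ^ 3) 1"
    proof -
      have "ring_cong 1 (of_int (2 * int n)) (of_int (int s))"
      proof (rule ring_cong_of_int)
        have "2 * int n - int s = int p" using p_eq by (simp add: n_def)
        then show "[2 * int n = int s] (mod int p)" by (simp add: cong_iff_dvd_diff)
      qed
      then have "ring_cong 1 (2 * of_nat n) (of_nat s)" by simp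
      then have "ring_cong 1 ((2 * of_nat n) ^ 3 / of_nat s ^ 3) (of_nat s ^ 3 / of_nat s ^ 3)"
        by (intro ring_cong_divide ring_cong_power ring_cong_refl Rcyc_mult Rcyc_power Rcyc_basic Ucyc_power Ucyc_of_nat s)
      then show ?thesis using s by simp
    qed
    have "ring_cong 1 ((-1) ^ Suc n * 80 * of_int r / 81 * H * S)
      ((-1) ^ Suc n * 80 * (- 3 * of_nat n) / 81 * ((1 / fact (n - 1)) ^ 2 / ((1 / fact (s - 1)) ^ 3 * ((-1) ^ Suc n * fact n) ^ 4))
        * ((fact n / fact s) ^ 3 * Sig))"
      by (intro ring_cong_mult[OF ring_cong_mult[OF ring_cong_divide[OF ring_cong_mult[OF ring_cong_refl rr] ring_cong_refl] H] S_cong]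
        Rcyc_mult Rcyc_divide HR Rcyc_S sg Ucyc_81 Rcyc_of_int Rcyc_basic Rcyc_uminus Rcyc_power
        Ucyc_Rcyc[OF fn] Ucyc_power Ucyc_mult fs Ucyc_minus_1 fact_Ucyc_le order_refl)
    also have "(-1) ^ Suc n * 80 * (- 3 * of_nat n) / 81 * ((1 / fact (n - 1)) ^ 2 / ((1 / fact (s - 1)) ^ 3 * ((-1) ^ Suc n * fact n) ^ 4))
        * ((fact n / fact s) ^ 3 * Sig)
      = 10 / 27 * (-1) ^ n / fact n ^ 3 * Sig * ((2 * of_nat n) ^ 3 / of_nat s ^ 3)"
    proof -
      define x y where "x = (fact (n - 1) :: complex)" and "y = (fact (s - 1) :: complex)"
      have xy: "fact n = of_nat n * x" "fact s = of_nat s * y" "x \<noteq> 0" "y \<noteq> 0" "of_nat n \<noteq> (0::complex)" "of_nat s \<noteq> (0::complex)"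
        using n_pos s by (simp_all add: x_def y_def fact_reduce)
      have e: "((-1) ^ Suc n * (of_nat n * x)) ^ 4 = (of_nat n * x) ^ 4"
        by (simp add: power_mult_distrib power_mult[symmetric])
      show ?thesis unfolding x_def[symmetric] y_def[symmetric] xy(1,2) e
        using xy(3-) by (simp add: divide_simps) (simp add: eval_nat_numeral mult_ac)
    qed
    also have "ring_cong 1 (10 / 27 * (-1) ^ n / fact n ^ 3 * Sig * ((2 * of_nat n) ^ 3 / of_nat s ^ 3)) (10 / 27 * (-1) ^ n / fact n ^ 3 * Sig * 1)"
      using s by (intro ring_cong_mult ring_cong_refl nn Rcyc_mult Rcyc_divide Rcyc_Sig sg Ucyc_27 Ucyc_power fact_Ucyc_le
        Rcyc_basic order_refl Rcyc_power Ucyc_of_nat)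
    finally show ?thesis by (simp add: ring_cong_sym)
  qed
  from ring_cong_trans[OF Y_cong this] show ?thesis
    unfolding sgn H_def .
qed

lemma main_ring_cong:
  assumes m: "m1 > 0" "m2 > 0" "m3 > 0"
    and "[3 * int m1 = 3 + r] (mod int p)" "[3 * int m2 = 3 + 2 * r] (mod int p)" "[3 * int m3 = 3 - r] (mod int p)"
  defines "G \<equiv> \<lambda>m. of_int (gamma_p_nat p m) :: complex"
  shows "ring_cong 5 (\<Sum>k<p. of_int (6 * int k + r) * pochhammer a k ^ 6 / fact k ^ 6)
    ((-1) powi (r + 1) * 80 * of_int r * of_nat p ^ 4 / 81 * (G m1 ^ 2 / (G m2 ^ 3 * G m3 ^ 4)) * S)"
proof -
  obtain w where w: "w \<in> Rcyc"
    "Y - (-1) powi (r + 1) * 80 * of_int r / 81 * (G m1 ^ 2 / (G m2 ^ 3 * G m3 ^ 4)) * S = of_nat p ^ 1 * w"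
    using Y_cong_rhs[OF assms(1-6)] unfolding ring_cong_def G_def by blast
  have "L - (-1) powi (r + 1) * 80 * of_int r * of_nat p ^ 4 / 81 * (G m1 ^ 2 / (G m2 ^ 3 * G m3 ^ 4)) * S
    = of_nat p ^ 4 * (Y - (-1) powi (r + 1) * 80 * of_int r / 81 * (G m1 ^ 2 / (G m2 ^ 3 * G m3 ^ 4)) * S)"
    unfolding L_eq_Y by (simp add: algebra_simps)
  also have "\<dots> = of_nat p ^ 5 * w" unfolding w(2) by (simp add: eval_nat_numeral)
  finally have "ring_cong 5 L ((-1) powi (r + 1) * 80 * of_int r * of_nat p ^ 4 / 81 * (G m1 ^ 2 / (G m2 ^ 3 * G m3 ^ 4)) * S)"
    unfolding ring_cong_def using w(1) by blast
  then show ?thesis using L_cong ring_cong_trans by blast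
qed

end

section \<open>Transfer to rational numbers\<close>

lemma of_rat_pochhammer: "of_rat (pochhammer x k) = (pochhammer (of_rat x) k :: 'a::field_char_0)"
  by (simp add: pochhammer_prod of_rat_prod of_rat_add)

lemma of_rat_fact: "of_rat (fact k) = (fact k :: 'a::field_char_0)"
  by (metis of_nat_fact of_rat_of_nat_eq)

lemma of_rat_minus_one_powi: "of_rat ((-1) powi k) = ((-1) powi k :: 'a::field_char_0)"
  by (cases "even k") (auto simp: power_int_minus_left of_rat_minus)

text \<open>Each value of \<open>Gamma_p\<close> at a fraction is represented by its values along an
  arbitrary sequence of positive integers tending to that fraction. The Gamma quotient stands next
  to \<open>p^4\<close>, so its residue modulo \<open>p\<close> decides, and the congruence holds as
  soon as the sequences are correct modulo \<open>p\<close>.\<close>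

theorem theorem2:
  fixes r :: int and p :: nat
  assumes "r \<le> 1"
    and "coprime r 3"
    and "prime p"
    and "[int p = - r] (mod 3)"
    and "int p \<ge> 3 - r"
    and "\<forall>j. n1 j > 0" and "\<forall>j. n2 j > 0" and "\<forall>j. n3 j > 0"
    and "padic_tendsto p n1 (1 + of_int r / 3)"
    and "padic_tendsto p n2 (1 + 2 * of_int r / 3)"
    and "padic_tendsto p n3 (1 - of_int r / 3)"
  shows "\<forall>\<^sub>F j in sequentially.
    padic_cong p 5
      (\<Sum>k<p. of_int (6 * int k + r) * pochhammer (of_int r / 3 :: rat) k ^ 6 / (fact k) ^ 6)
      ((-1) powi (r + 1) * 80 * of_int r * of_nat p ^ 4 / 81
        * (of_int (gamma_p_nat p (n1 j)) ^ 2
           / (of_int (gamma_p_nat p (n2 j)) ^ 3 * of_int (gamma_p_nat p (n3 j)) ^ 4))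
        * (\<Sum>k=0..nat (1 - r). pochhammer (of_int (r - 1) :: rat) k * pochhammer (of_int r / 3) k ^ 3
              / (pochhammer 1 k * pochhammer (2 * of_int r / 3) k ^ 3)))"
proof -
  define q s where "q = nat ((int p + r) div 3)" and "s = nat ((int p - 2 * r) div 3)"
  have "3 dvd int p + r"
    using assms(4) by (simp add: cong_iff_dvd_diff)
  moreover from this have "3 dvd int p - 2 * r" by presburger
  ultimately have qs: "3 * int q = int p + r" "3 * int s = int p - 2 * r"
    using assms(1,5) unfolding q_def s_def by auto
  have r: "r = int q - int s" using qs by simp
  have "\<not> 3 dvd r"
  proof
    assume "3 dvd r"
    then have "is_unit (3 :: int)" using coprime_common_divisor[OF assms(2), of 3] by simp
    then show False by simp
  qed
  \<comment> \<open>With \<open>3 q = p + r\<close> and \<open>3 s = p - 2 r\<close>, the bound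
    \<open>p \<ge> 3 - r\<close> becomes \<open>0 < q\<close>, and \<open>r \<le> 1\<close> becomes
    \<open>q \<le> Suc s\<close>.\<close>
  then interpret X: theorem2_setting p q s
    using assms(1,3,5) qs by unfold_locales (auto simp: r)
  have Xr: "X.r = r" unfolding X.r_def r ..
  have Xa: "X.a = of_rat (of_int r / 3)" by (simp add: X.a_def Xr of_rat_divide)
  have XN: "X.N = nat (1 - r)" using r qs X.q_le by (simp add: X.N_def nat_diff_distrib')
  \<comment> \<open>The limit is used at precision \<open>K = 1\<close>.\<close>
  have ev: "\<forall>\<^sub>F j in sequentially. [3 * int (f j) = k] (mod int p)"
    if f: "padic_tendsto p f x" and x: "x = of_int k / of_int 3" for f k x
  proof -
    obtain J where J: "\<And>j. j \<ge> J \<Longrightarrow> padic_cong p 1 (of_nat (f j)) x"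
      using f unfolding padic_tendsto_def by blast
    show ?thesis
      unfolding eventually_sequentially
    proof (intro exI[of _ J] allI impI)
      fix j assume "J \<le> j"
      then show "[3 * int (f j) = k] (mod int p)"
        using X.padic_cong_nat_imp_cong[of "f j" k 3] J[of j] unfolding x by simp
    qed
  qed
  have "\<forall>\<^sub>F j in sequentially. [3 * int (n1 j) = 3 + r] (mod int p)"
    by (rule ev[OF assms(9)]) (simp add: add_divide_distrib)
  moreover have "\<forall>\<^sub>F j in sequentially. [3 * int (n2 j) = 3 + 2 * r] (mod int p)"
    by (rule ev[OF assms(10)]) (simp add: add_divide_distrib)
  moreover have "\<forall>\<^sub>F j in sequentially. [3 * int (n3 j) = 3 - r] (mod int p)"
    by (rule ev[OF assms(11)]) (simp add: diff_divide_distrib)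
  ultimately show ?thesis
  proof eventually_elim
    case (elim j)
    have S: "of_rat (\<Sum>k=0..nat (1 - r). pochhammer (of_int (r - 1) :: rat) k * pochhammer (of_int r / 3) k ^ 3
              / (pochhammer 1 k * pochhammer (2 * of_int r / 3) k ^ 3)) = X.S"
      unfolding X.S_def XN Xa Xr atMost_atLeast0
      by (simp add: of_rat_sum of_rat_divide of_rat_mult of_rat_power of_rat_pochhammer of_rat_diff)
    show ?case
    proof (rule X.ring_cong_imp_padic_cong)
      show "X.ring_cong 5
       (of_rat (\<Sum>k<p. of_int (6 * int k + r) * pochhammer (of_int r / 3 :: rat) k ^ 6 / (fact k) ^ 6))
       (of_rat ((-1) powi (r + 1) * 80 * of_int r * of_nat p ^ 4 / 81
        * (of_int (gamma_p_nat p (n1 j)) ^ 2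
           / (of_int (gamma_p_nat p (n2 j)) ^ 3 * of_int (gamma_p_nat p (n3 j)) ^ 4))
        * (\<Sum>k=0..nat (1 - r). pochhammer (of_int (r - 1) :: rat) k * pochhammer (of_int r / 3) k ^ 3
              / (pochhammer 1 k * pochhammer (2 * of_int r / 3) k ^ 3))))"
        using X.main_ring_cong[of "n1 j" "n2 j" "n3 j"] elim assms(6-8)
        unfolding of_rat_mult[of _ "\<Sum>k=0..nat (1 - r). _ k"] S Xr Xa
        by (simp add: of_rat_sum of_rat_divide of_rat_mult of_rat_power of_rat_pochhammer of_rat_diff of_rat_add
          of_rat_fact of_rat_minus_one_powi)
    qed
  qed
qed

end
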